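(* Let $V$ be a finite-dimensional real inner product space, let $g\colon V\to(-\infty,+\infty]$ be a proper convex lower semicontinuous function, and let $F\colon \operatorname{dom} g\to V$ be monotone, i.e. $\langle F(u)-F(v),u-v\rangle\ge 0$ for all $u,v\in\operatorname{dom} g$, and locally Lipschitz. Assume that the solution set $S$ of the variational inequality $$\text{find } z^*\in V \text{ such that } \langle F(z^* ),z-z^*\rangle+g(z)-g(z^* )\ge 0\quad \forall z\in V$$ is nonempty. Then the sequences $(z^k)$ and $(\bar z^k)$ generated by the adaptive Golden Ratio Algorithm (aGRAAL, described in the context) converge to a solution of this variational inequality.
   Context: $\|\cdot\|=\sqrt{\langle\cdot,\cdot\rangle}$; $\operatorname{dom} g=\{x\in V: g(x)<+\infty\}$; for $\lambda>0$, $\operatorname{prox}_{\lambda g}(z)=\operatorname{argmin}_{x\in V}\{\lambda g(x)+\frac12\|x-z\|^2\}$. Solutions $z^*$ of the variational inequality are understood to lie in $\operatorname{dom} g$. Adaptive Golden Ratio Algorithm (aGRAAL). Let $\varphi=\frac{\sqrt5+1}{2}$. Input: $z^0,z^1\in\operatorname{dom} g$, $\lambda_0>0$, $\phi\in(1,\varphi]$, $\bar\lambda>0$. Set $\bar z^0=z^1$, $\theta_0=1$, $\rho=\frac1\phi+\frac1{\phi^2}$. For $k\ge1$: 1. $\displaystyle \lambda_k=\min\Bigl\{\rho\lambda_{k-1},\ \frac{\phi\,\theta_{k-1}}{4\lambda_{k-1}}\frac{\|z^k-z^{k-1}\|^2}{\|F(z^k)-F(z^{k-1})\|^2},\ \bar\lambda\Bigr\}$,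 where a quotient with zero denominator (including $\frac00$) is taken to be $+\infty$; 2. $\displaystyle \bar z^k=\frac{(\phi-1)z^k+\bar z^{k-1}}{\phi}$, $\quad z^{k+1}=\operatorname{prox}_{\lambda_k g}(\bar z^k-\lambda_kF(z^k))$; 3. $\displaystyle \theta_k=\phi\,\frac{\lambda_k}{\lambda_{k-1}}$. *)

theory Defs
  imports "HOL-Analysis.Analysis"
begin

definition effective_domain :: "('a \<Rightarrow> ereal) \<Rightarrow> 'a set" where
  "effective_domain g = {x. g x < \<infinity>}"

definition proper :: "('a \<Rightarrow> ereal) \<Rightarrow> bool" where
  "proper g \<longleftrightarrow> (\<forall>x. g x \<noteq> -\<infinity>) \<and> effective_domain g \<noteq> {}"

text \<open>The library predicate \<^const>\<open>convex_on\<close> covers real-valued functions only. The right-hand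
  side below is meant for functions that omit the value minus infinity; zero times infinity
  is zero in \<^typ>\<open>ereal\<close>.\<close>

definition ereal_convex :: "('a::real_vector \<Rightarrow> ereal) \<Rightarrow> bool" where
  "ereal_convex g \<longleftrightarrow>
    (\<forall>x y u v. 0 \<le> u \<and> 0 \<le> v \<and> u + v = 1 \<longrightarrow>
      g (u *\<^sub>R x + v *\<^sub>R y) \<le> ereal u * g x + ereal v * g y)"

definition lower_semicontinuous :: "('a::topological_space \<Rightarrow> ereal) \<Rightarrow> bool" where
  "lower_semicontinuous g \<longleftrightarrow> (\<forall>x c. c < g x \<longrightarrow> (\<forall>\<^sub>F y in nhds x. c < g y))"

definition monotone_operator_on :: "'a::real_inner set \<Rightarrow> ('a \<Rightarrow> 'a) \<Rightarrow> bool" where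
  "monotone_operator_on D F \<longleftrightarrow> (\<forall>u\<in>D. \<forall>v\<in>D. 0 \<le> (F u - F v) \<bullet> (u - v))"

text \<open>The parameter-free version of \<^const>\<open>local_lipschitz\<close>; neighbourhoods are relative to the
  set on which the function lives.\<close>

definition locally_lipschitz_on ::
    "'a::metric_space set \<Rightarrow> ('a \<Rightarrow> 'b::metric_space) \<Rightarrow> bool" where
  "locally_lipschitz_on D F \<longleftrightarrow>
    (\<forall>x\<in>D. \<exists>r>0. \<exists>L. lipschitz_on L (cball x r \<inter> D) F)"

definition VI_solutions :: "('a::real_inner \<Rightarrow> ereal) \<Rightarrow> ('a \<Rightarrow> 'a) \<Rightarrow> 'a set" where
  "VI_solutions g F =
    {s \<in> effective_domain g. \<forall>z. 0 \<le> ereal (F s \<bullet> (z - s)) + g z - g s}"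

text \<open>For a proper convex lower semicontinuous function and a positive parameter the minimiser
  exists and is unique, so the choice made by \<^const>\<open>arg_min\<close> is immaterial.\<close>

definition prox :: "real \<Rightarrow> ('a::real_inner \<Rightarrow> ereal) \<Rightarrow> 'a \<Rightarrow> 'a" where
  "prox l g z = (ARG_MIN (\<lambda>x. ereal l * g x + ereal (1 / 2 * (norm (x - z))\<^sup>2)) x. True)"

definition ext_quotient :: "real \<Rightarrow> real \<Rightarrow> ereal" where
  "ext_quotient a b = (if b = 0 then \<infinity> else ereal (a / b))"

text \<open>In the step size rule the factor in front of the quotient is positive, so an infinite
  quotient makes the middle term of the minimum infinite. The sequences \<open>zb\<close>, \<open>lam\<close> and \<open>theta\<close>
  are the averaged points, the step sizes and the auxiliary ratios; together with \<open>z\<close> they are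
  determined by \<open>z 0\<close>, \<open>z 1\<close> and \<open>lam 0\<close>.\<close>

definition aGRAAL ::
    "('a::real_inner \<Rightarrow> ereal) \<Rightarrow> ('a \<Rightarrow> 'a) \<Rightarrow> real \<Rightarrow> real \<Rightarrow>
      (nat \<Rightarrow> 'a) \<Rightarrow> (nat \<Rightarrow> 'a) \<Rightarrow> (nat \<Rightarrow> real) \<Rightarrow> (nat \<Rightarrow> real) \<Rightarrow> bool" where
  "aGRAAL g F phi lam_max z zb lam theta \<longleftrightarrow>
    zb 0 = z 1 \<and> theta 0 = 1 \<and>
    (\<forall>k\<ge>1.
      ereal (lam k) =
        Min {ereal ((1 / phi + 1 / phi\<^sup>2) * lam (k - 1)),
             ereal (phi * theta (k - 1) / (4 * lam (k - 1))) *
               ext_quotient ((norm (z k - z (k - 1)))\<^sup>2) ((norm (F (z k) - F (z (k - 1))))\<^sup>2),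
             ereal lam_max} \<and>
      zb k = ((phi - 1) *\<^sub>R z k + zb (k - 1)) /\<^sub>R phi \<and>
      z (k + 1) = prox (lam k) g (zb k - lam k *\<^sub>R F (z k)) \<and>
      theta k = phi * (lam k / lam (k - 1)))"

end

theory Submission
  imports Defs
begin

text \<open>For \<open>w\<close> in the domain of \<open>g\<close> put
  \<open>E n w = phi / (phi - 1) * (norm (zb (n+1) - w))\<^sup>2 + theta n / 2 * (norm (z (n+1) - z n))\<^sup>2\<close>.
  Adding the prox inequalities of two consecutive steps, and estimating the change of \<open>F\<close> by the step
  size rule, bounds \<open>E (n+1) w\<close> by \<open>E n w\<close> minus two residual terms and minus
  \<open>2 * lam (n+1) * (F w \<bullet> (z (n+1) - w) + g (z (n+1)) - g w)\<close>. For a solution \<open>w\<close> everything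
  subtracted is nonnegative, so the iterates are bounded and the residuals vanish.

  The domain need not be closed and \<open>F\<close> may be unbounded near its boundary, so a positive lower bound
  on the step sizes is not available at once. One first shows that all cluster points lie in the
  domain. Near a point outside it \<open>g\<close> is large, which forces the iterates to converge to such a
  cluster point \<open>b\<close>, and makes \<open>E n w\<close> eventually decreasing for all \<open>w\<close>. Then a limiting direction
  of \<open>zb n - b\<close> is a normal as well as a tangent direction of the domain at \<open>b\<close>, hence zero, which is
  absurd. By compactness \<open>F\<close> is now Lipschitz along the steps, the step sizes stay away from zero,
  every cluster point solves the variational inequality, and monotonicity of the energy at a cluster
  point yields convergence.\<close>

subsection \<open>The proximal map\<close>

text \<open>Lower semicontinuity at a cluster point of a minimising sequence excludes a value above
  the infimum.\<close>

lemma lower_semicontinuous_attains_min: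
  fixes f :: "'a::metric_space \<Rightarrow> ereal"
  assumes "lower_semicontinuous f" and "compact K" and "K \<noteq> {}"
  obtains x where "x \<in> K" and "\<And>y. y \<in> K \<Longrightarrow> f x \<le> f y"
proof -
  obtain u where u: "range u \<subseteq> f ` K" "u \<longlonglongrightarrow> Inf (f ` K)"
    using Inf_as_limit[of "f ` K"] assms(3) by blast
  then have "\<forall>n. \<exists>x\<in>K. u n = f x" by blast
  then obtain x where x: "\<And>n. x n \<in> K" "\<And>n. u n = f (x n)" by metis
  obtain l r where lr: "l \<in> K" "strict_mono r" "(x \<circ> r) \<longlonglongrightarrow> l"
    using seq_compactE[OF compact_imp_seq_compact[OF assms(2)], of x] x(1) by blast
  have "f l \<le> Inf (f ` K)"
  proof (rule ccontr)
    assume "\<not> ?thesis"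
    then obtain c where c: "Inf (f ` K) < c" "c < f l"
      using dense[of "Inf (f ` K)" "f l"] by (auto simp: not_le)
    have "\<forall>\<^sub>F n in sequentially. c < f ((x \<circ> r) n)"
      using assms(1) c(2) by (intro eventually_compose_filterlim[OF _ lr(3)])
        (simp add: lower_semicontinuous_def)
    moreover have "(\<lambda>n. f ((x \<circ> r) n)) \<longlonglongrightarrow> Inf (f ` K)"
      using LIMSEQ_subseq_LIMSEQ[OF u(2) lr(2)] x(2) by (simp add: o_def)
    then have "\<forall>\<^sub>F n in sequentially. f ((x \<circ> r) n) < c"
      using c(1) by (rule order_tendstoD)
    ultimately have "\<forall>\<^sub>F n::nat in sequentially. False" by eventually_elim auto
    then show False by simp
  qed
  then have "f l \<le> f y" if "y \<in> K" for y using INF_lower[OF that, of f] by (rule order_trans)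
  then show thesis by (rule that[OF lr(1)])
qed

text \<open>A level below the sum is split into a level \<open>d\<close> for \<open>g\<close> and
  the remaining share for \<open>q\<close>, with strict room in both; each then persists in a
  neighbourhood.\<close>

lemma lower_semicontinuous_scale_add_continuous:
  fixes g :: "'a::t2_space \<Rightarrow> ereal" and q :: "'a \<Rightarrow> real"
  assumes "lower_semicontinuous g" and "continuous_on UNIV q" and "0 < l"
    and "\<And>x. g x \<noteq> -\<infinity>"
  shows "lower_semicontinuous (\<lambda>x. ereal l * g x + ereal (q x))"
  unfolding lower_semicontinuous_def
proof (intro allI impI)
  fix x and c :: ereal assume "c < ereal l * g x + ereal (q x)"
  then obtain c' where c': "c < ereal c'" "ereal c' < ereal l * g x + ereal (q x)"
    using ereal_dense2 by blast
  have "ereal ((c' - q x) / l) < g x"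
    using c'(2) assms(3) assms(4)[of x] by (cases "g x") (auto simp: field_simps)
  then obtain d where d: "ereal ((c' - q x) / l) < ereal d" "ereal d < g x"
    using ereal_dense2 by blast
  have "\<forall>\<^sub>F y in nhds x. ereal d < g y"
    using assms(1) d(2) by (auto simp: lower_semicontinuous_def)
  moreover have "(q \<longlongrightarrow> q x) (nhds x)"
    using assms(2) by (simp add: continuous_on_eq_continuous_at isCont_def flip: tendsto_at_iff_tendsto_nhds)
  then have "\<forall>\<^sub>F y in nhds x. c' - l * d < q y"
    by (rule order_tendstoD) (use d(1) assms(3) in \<open>simp add: field_simps\<close>)
  ultimately show "\<forall>\<^sub>F y in nhds x. c < ereal l * g y + ereal (q y)"
  proof eventually_elim
    case (elim y)
    have "ereal c' < ereal l * g y + ereal (q y)"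
    proof (cases "g y")
      case (real a)
      then have "l * d < l * a" using elim(1) assms(3) by simp
      then show ?thesis using elim(2) real by simp
    qed (use elim assms(3,4) in auto)
    then show ?case using c'(1) by (rule less_trans[rotated])
  qed
qed

text \<open>Lower semicontinuity bounds \<open>g\<close> below on the unit ball around a point
  \<open>x0\<close> of finite value. Descending outside the ball faster than with slope
  \<open>M\<close> would, by convexity, force too small a value where the segment from
  \<open>x0\<close> leaves the ball.\<close>

lemma ereal_convex_linear_lower_bound:
  fixes g :: "'a::euclidean_space \<Rightarrow> ereal"
  assumes "proper g" and "ereal_convex g" and "lower_semicontinuous g"
  obtains a M where "0 \<le> M" and "\<And>x. ereal (a - M * norm x) \<le> g x"
proof -
  have fin: "\<And>x. g x \<noteq> -\<infinity>" using assms(1) by (auto simp: proper_def)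
  obtain x0 where "g x0 < \<infinity>" using assms(1) by (auto simp: proper_def effective_domain_def)
  then obtain g0 where g0: "g x0 = ereal g0" using fin[of x0] by (cases "g x0") auto
  obtain x1 where x1: "\<And>y. y \<in> cball x0 1 \<Longrightarrow> g x1 \<le> g y"
    using lower_semicontinuous_attains_min[OF assms(3) compact_cball, of x0 1] by auto
  define m where "m = real_of_ereal (g x1)"
  have m: "g x1 = ereal m" using x1[of x0] g0 fin[of x1] by (cases "g x1") (auto simp: m_def)
  define M where "M = g0 - m"
  have M: "0 \<le> M" using x1[of x0] m g0 by (simp add: M_def)
  have *: "ereal (m - M * norm (x - x0)) \<le> g x" for x
  proof (cases "norm (x - x0) \<le> 1")
    case True
    then have "ereal m \<le> g x" using x1[of x] m by (simp add: dist_norm norm_minus_commute)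
    moreover have "m - M * norm (x - x0) \<le> m" using M by simp
    ultimately show ?thesis using order_trans[of _ "ereal m" "g x"] by simp
  next
    case False
    define t where "t = norm (x - x0)"
    have t: "1 < t" using False by (simp add: t_def)
    have "(1 - 1/t) *\<^sub>R x0 + (1/t) *\<^sub>R x \<in> cball x0 1"
    proof -
      have "x0 - ((1 - 1/t) *\<^sub>R x0 + (1/t) *\<^sub>R x) = (1/t) *\<^sub>R (x0 - x)" by (simp add: algebra_simps)
      then show ?thesis using t by (simp add: dist_norm norm_minus_commute t_def)
    qed
    then have "ereal m \<le> g ((1 - 1/t) *\<^sub>R x0 + (1/t) *\<^sub>R x)" using x1 m by metis
    also have "\<dots> \<le> ereal (1 - 1/t) * g x0 + ereal (1/t) * g x"
      using assms(2) t by (simp add: ereal_convex_def)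
    finally have *: "ereal m \<le> ereal (1 - 1/t) * g x0 + ereal (1/t) * g x" .
    show ?thesis
    proof (cases "g x")
      case (real a)
      have "m \<le> (1 - 1/t) * g0 + 1/t * a" using * real g0 by simp
      then have "m * t \<le> (t - 1) * g0 + a" using t by (simp add: field_simps)
      moreover have "m + M * 1 = g0" by (simp add: M_def)
      ultimately have "m - M * t \<le> a" using M t by (simp add: M_def algebra_simps)
      then show ?thesis using real by (simp add: t_def)
    qed (use fin in auto)
  qed
  have "ereal ((m - M * norm x0) - M * norm x) \<le> g x" for x
  proof -
    have "M * norm (x - x0) \<le> M * (norm x + norm x0)"
      by (rule mult_left_mono[OF norm_triangle_ineq4 M])
    then have "(m - M * norm x0) - M * norm x \<le> m - M * norm (x - x0)"
      by (simp add: algebra_simps)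
    then have "ereal ((m - M * norm x0) - M * norm x) \<le> ereal (m - M * norm (x - x0))" by simp
    then show ?thesis using * by (rule order_trans)
  qed
  then show thesis using that[OF M] by blast
qed

text \<open>The linear lower bound on \<open>g\<close> makes the objective coercive, so a minimiser
  over a large ball is global. As \<open>prox\<close> is a choice among minimisers, exhibiting one
  suffices.\<close>

lemma prox_is_arg_min:
  fixes g :: "'a::euclidean_space \<Rightarrow> ereal"
  assumes "proper g" and "ereal_convex g" and "lower_semicontinuous g" and "0 < l"
  shows "ereal l * g (prox l g v) + ereal (1 / 2 * (norm (prox l g v - v))\<^sup>2)
    \<le> ereal l * g x + ereal (1 / 2 * (norm (x - v))\<^sup>2)"
proof -
  let ?f = "\<lambda>x. ereal l * g x + ereal (1 / 2 * (norm (x - v))\<^sup>2)"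
  have fin: "\<And>x. g x \<noteq> -\<infinity>" using assms(1) by (auto simp: proper_def)
  obtain a M where aM: "0 \<le> M" "\<And>x. ereal (a - M * norm x) \<le> g x"
    using ereal_convex_linear_lower_bound[OF assms(1-3)] by blast
  obtain x0 where "g x0 < \<infinity>" using assms(1) by (auto simp: proper_def effective_domain_def)
  then obtain g0 where g0: "g x0 = ereal g0" using fin[of x0] by (cases "g x0") auto
  define f0 where "f0 = l * g0 + 1 / 2 * (norm (x0 - v))\<^sup>2"
  define n where "n = norm v"
  define b where "b = l * (a - M * n) - f0"
  \<comment> \<open>With \<open>u = t - n\<close>, the objective at norm \<open>t\<close> exceeds
    \<open>f0\<close> by at least \<open>u * (u - 2 * (l * M)) / 2 + b\<close>; \<open>T\<close>
    makes the first factor at least 1 and the second at least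
    \<open>2 * \<bar>b\<bar> + 1\<close>.\<close>
  define T where "T = n + 2 * (l * M) + 2 * \<bar>b\<bar> + 1"
  have lM: "0 \<le> l * M" using aM(1) assms(4) by simp
  have T: "f0 < l * (a - M * t) + 1 / 2 * (t - n)\<^sup>2" if "T \<le> t" for t
  proof -
    define u where "u = t - n"
    have u: "1 \<le> u" using that lM unfolding u_def T_def by linarith
    have u': "2 * \<bar>b\<bar> + 1 \<le> u - 2 * (l * M)" using that unfolding u_def T_def by linarith
    have "1 * (2 * \<bar>b\<bar> + 1) \<le> u * (u - 2 * (l * M))"
      using u u' by (intro mult_mono) auto
    then have "2 * \<bar>b\<bar> + 1 \<le> u * (u - 2 * (l * M))" by simp
    moreover have "- b \<le> \<bar>b\<bar>" by simp
    ultimately have "0 < u * (u - 2 * (l * M)) + 2 * b" by linarith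
    then have "0 < u * (u - 2 * (l * M)) / 2 + b" by simp
    also have "\<dots> = l * (a - M * t) + 1 / 2 * (t - n)\<^sup>2 - f0"
      unfolding u_def b_def power2_eq_square by (simp add: field_simps)
    finally show ?thesis by simp
  qed
  have big: "ereal f0 < ?f y" if "T \<le> norm y" for y
  proof -
    have "(norm y - n)\<^sup>2 \<le> (norm (y - v))\<^sup>2"
      unfolding n_def by (metis norm_triangle_ineq3 abs_le_square_iff abs_norm_cancel)
    then have "f0 < l * (a - M * norm y) + 1 / 2 * (norm (y - v))\<^sup>2" using T[OF that] by linarith
    then have "ereal f0 < ereal l * ereal (a - M * norm y) + ereal (1 / 2 * (norm (y - v))\<^sup>2)" by simp
    also have "\<dots> \<le> ?f y"
      using aM(2)[of y] assms(4) by (intro add_right_mono ereal_mult_left_mono) auto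
    finally show ?thesis .
  qed
  have f0: "?f x0 = ereal f0" by (simp add: g0 f0_def)
  have x0: "norm x0 < T" using big[of x0] unfolding f0 by fastforce
  have "lower_semicontinuous ?f"
    by (intro lower_semicontinuous_scale_add_continuous assms fin continuous_intros)
  moreover have "0 \<le> T" using x0 norm_ge_zero[of x0] by linarith
  then have "cball 0 T \<noteq> ({} :: 'a set)" by simp
  ultimately obtain x1 where x1: "x1 \<in> cball 0 T" "\<And>y. y \<in> cball 0 T \<Longrightarrow> ?f x1 \<le> ?f y"
    using lower_semicontinuous_attains_min[of ?f "cball 0 T" thesis] compact_cball by simp
  have "?f x1 \<le> ?f y" for y
  proof (cases "norm y \<le> T")
    case False
    have "?f x1 \<le> ?f x0" using x1(2) x0 by simp
    also have "\<dots> < ?f y" using big[of y] False unfolding f0 by simp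
    finally show ?thesis by simp
  qed (use x1(2) in simp)
  then have "is_arg_min ?f (\<lambda>_. True) x1" by (auto simp: is_arg_min_def not_less)
  then have "is_arg_min ?f (\<lambda>_. True) (prox l g v)"
    unfolding prox_def arg_min_def by (rule someI)
  then show ?thesis by (auto simp: is_arg_min_def not_less)
qed

lemma prox_in_effective_domain:
  fixes g :: "'a::euclidean_space \<Rightarrow> ereal"
  assumes "proper g" and "ereal_convex g" and "lower_semicontinuous g" and "0 < l"
  shows "prox l g v \<in> effective_domain g"
proof -
  obtain x0 where "g x0 < \<infinity>" using assms(1) by (auto simp: proper_def effective_domain_def)
  moreover have "g x0 \<noteq> -\<infinity>" using assms(1) by (auto simp: proper_def)
  ultimately obtain g0 where "g x0 = ereal g0" by (cases "g x0") auto
  then show ?thesis using prox_is_arg_min[OF assms, of v x0] assms(4)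
    by (cases "g (prox l g v)") (auto simp: effective_domain_def)
qed

lemma effective_domain_ereal_real:
  assumes "proper g" and "x \<in> effective_domain g"
  shows "g x = ereal (real_of_ereal (g x))"
  using assms by (cases "g x") (auto simp: proper_def effective_domain_def)

lemma ereal_convex_effective_domain:
  assumes "proper g" and "ereal_convex g"
  shows "convex (effective_domain g)"
proof (rule convexI)
  fix x y and u v :: real
  assume *: "x \<in> effective_domain g" "y \<in> effective_domain g" "0 \<le> u" "0 \<le> v" "u + v = 1"
  have "g (u *\<^sub>R x + v *\<^sub>R y) \<le> ereal u * g x + ereal v * g y"
    using assms(2) *(3-5) by (simp add: ereal_convex_def)
  also have "\<dots> < \<infinity>"
  proof -
    obtain a b where "g x = ereal a" "g y = ereal b"
      using effective_domain_ereal_real[OF assms(1)] *(1,2) by blast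
    then show ?thesis by simp
  qed
  finally show "u *\<^sub>R x + v *\<^sub>R y \<in> effective_domain g" by (simp add: effective_domain_def)
qed

text \<open>First-order optimality without subdifferentials: compare the minimiser with points of
  the segment towards \<open>w\<close>, divide by \<open>t\<close> and let \<open>t\<close> tend to
  zero.\<close>

lemma prox_variational_inequality:
  fixes g :: "'a::euclidean_space \<Rightarrow> ereal" and v :: 'a
  assumes "proper g" and "ereal_convex g" and "lower_semicontinuous g" and "0 < l"
    and w: "w \<in> effective_domain g"
  defines "p \<equiv> prox l g v"
  shows "l * (real_of_ereal (g p) - real_of_ereal (g w)) \<le> (p - v) \<bullet> (w - p)"
proof -
  define Gp Gw where "Gp = real_of_ereal (g p)" and "Gw = real_of_ereal (g w)"
  have Gp: "g p = ereal Gp"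
    unfolding Gp_def p_def by (intro effective_domain_ereal_real prox_in_effective_domain assms)
  have Gw: "g w = ereal Gw" unfolding Gw_def by (intro effective_domain_ereal_real assms)
  have *: "l * (Gp - Gw) \<le> (p - v) \<bullet> (w - p) + t * ((norm (w - p))\<^sup>2 / 2)" if t: "0 < t" "t < 1" for t
  proof -
    let ?x = "(1 - t) *\<^sub>R p + t *\<^sub>R w"
    have "g ?x \<le> ereal (1 - t) * g p + ereal t * g w"
      using assms(2) t by (simp add: ereal_convex_def)
    then have "ereal l * g ?x \<le> ereal l * (ereal (1 - t) * g p + ereal t * g w)"
      using assms(4) by (intro ereal_mult_left_mono) simp_all
    then have "ereal l * g ?x \<le> ereal (l * ((1 - t) * Gp + t * Gw))" by (simp add: Gp Gw)
    then have "ereal l * g ?x + ereal (1 / 2 * (norm (?x - v))\<^sup>2)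
        \<le> ereal (l * ((1 - t) * Gp + t * Gw)) + ereal (1 / 2 * (norm (?x - v))\<^sup>2)"
      by (rule add_right_mono)
    then have "ereal l * g ?x + ereal (1 / 2 * (norm (?x - v))\<^sup>2)
        \<le> ereal (l * ((1 - t) * Gp + t * Gw) + 1 / 2 * (norm (?x - v))\<^sup>2)"
      unfolding plus_ereal.simps(1) .
    then have "ereal l * g p + ereal (1 / 2 * (norm (p - v))\<^sup>2)
        \<le> ereal (l * ((1 - t) * Gp + t * Gw) + 1 / 2 * (norm (?x - v))\<^sup>2)"
      using prox_is_arg_min[OF assms(1-4), of v ?x] unfolding p_def by (rule order_trans[rotated])
    then have "l * Gp + 1 / 2 * (norm (p - v))\<^sup>2 \<le> l * ((1 - t) * Gp + t * Gw) + 1 / 2 * (norm (?x - v))\<^sup>2"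
      by (simp add: Gp)
    moreover have "(norm (?x - v))\<^sup>2 = (norm (p - v))\<^sup>2 + 2 * t * ((p - v) \<bullet> (w - p)) + t\<^sup>2 * (norm (w - p))\<^sup>2"
      unfolding power2_norm_eq_inner
      by (simp add: inner_diff_left inner_diff_right inner_add_left inner_add_right
          inner_commute algebra_simps power2_eq_square)
    ultimately have "t * (l * (Gp - Gw)) \<le> t * ((p - v) \<bullet> (w - p) + t * ((norm (w - p))\<^sup>2 / 2))"
      by (simp add: algebra_simps power2_eq_square)
    then show ?thesis using t by simp
  qed
  have "((\<lambda>t. (p - v) \<bullet> (w - p) + t * ((norm (w - p))\<^sup>2 / 2)) \<longlongrightarrow>
      (p - v) \<bullet> (w - p) + 0 * ((norm (w - p))\<^sup>2 / 2)) (at_right 0)"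
    by (intro tendsto_intros)
  moreover have "\<forall>\<^sub>F t in at_right 0. l * (Gp - Gw) \<le> (p - v) \<bullet> (w - p) + t * ((norm (w - p))\<^sup>2 / 2)"
    using eventually_at_right_less[of "0::real"] eventually_at_right_real[OF zero_less_one]
    by eventually_elim (use * in auto)
  ultimately have "l * (Gp - Gw) \<le> (p - v) \<bullet> (w - p) + 0 * ((norm (w - p))\<^sup>2 / 2)"
    by (rule tendsto_lowerbound) simp
  then show ?thesis by (simp add: Gp_def Gw_def)
qed

subsection \<open>Sequences and supporting hyperplanes\<close>

text \<open>With \<open>a\<close> the new iterate and \<open>b\<close>, \<open>c\<close> consecutive
  averages, the inner product of the prox inequality becomes a telescoping difference. The
  coefficient \<open>1 + 1 / phi\<close> is the budget later given to \<open>theta\<close>.\<close>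

lemma averaging_energy_identity:
  fixes a b c w :: "'a::real_inner" and phi :: real
  assumes "1 < phi" and "phi *\<^sub>R c = (phi - 1) *\<^sub>R a + b"
  shows "2 * ((a - b) \<bullet> (w - a)) =
    phi / (phi - 1) * ((norm (b - w))\<^sup>2 - (norm (c - w))\<^sup>2) - (1 + 1 / phi) * (norm (a - b))\<^sup>2"
proof -
  define A B where "A = a - w" and "B = b - w"
  have "phi *\<^sub>R (c - w) = (phi - 1) *\<^sub>R A + B"
    using assms(2) by (simp add: A_def B_def algebra_simps)
  then have "(norm (phi *\<^sub>R (c - w)))\<^sup>2 = (norm ((phi - 1) *\<^sub>R A + B))\<^sup>2" by simp
  then have C: "phi\<^sup>2 * (norm (c - w))\<^sup>2 = (phi - 1)\<^sup>2 * (A \<bullet> A) + 2 * (phi - 1) * (A \<bullet> B) + B \<bullet> B"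
    unfolding power2_norm_eq_inner
    by (simp add: inner_add_left inner_add_right inner_commute power2_eq_square algebra_simps)
  have "(norm (c - w))\<^sup>2 = ((phi - 1)\<^sup>2 * (A \<bullet> A) + 2 * (phi - 1) * (A \<bullet> B) + B \<bullet> B) / phi\<^sup>2"
    unfolding C[symmetric] using assms(1) by simp
  moreover have "(norm (b - w))\<^sup>2 = B \<bullet> B" by (simp add: B_def power2_norm_eq_inner)
  moreover have "a - b = A - B" "w - a = - A" by (simp_all add: A_def B_def)
  moreover
  have "phi / (phi - 1) * (y - ((phi - 1)\<^sup>2 * x + 2 * (phi - 1) * t + y) / phi\<^sup>2)
      - (1 + 1 / phi) * (x - 2 * t + y) = 2 * t - 2 * x" for x y t :: real
    using assms(1) by (simp add: divide_simps) (simp add: algebra_simps power2_eq_square)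
  note this[of "B \<bullet> B" "A \<bullet> A" "A \<bullet> B"]
  moreover have "(norm (A - B))\<^sup>2 = A \<bullet> A - 2 * (A \<bullet> B) + B \<bullet> B"
    unfolding power2_norm_eq_inner by (simp add: inner_diff_left inner_diff_right inner_commute)
  moreover have "2 * ((A - B) \<bullet> (- A)) = 2 * (A \<bullet> B) - 2 * (A \<bullet> A)"
    by (simp add: inner_diff_right inner_commute)
  ultimately show ?thesis by metis
qed

text \<open>Once \<open>d n\<close> is below \<open>(1 - q) * (e / 2)\<close>, the value
  \<open>e / 2\<close> is a fixed point of the worst-case recursion, and any excess over it shrinks
  by the factor \<open>q\<close>.\<close>

lemma perturbed_contraction_tendsto_zero:
  fixes x d :: "nat \<Rightarrow> real"
  assumes "\<And>n. 0 \<le> x n" and "0 \<le> q" and "q < 1"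
    and step: "\<And>n. x (Suc n) \<le> d n + q * x n" and "d \<longlonglongrightarrow> 0"
  shows "x \<longlonglongrightarrow> 0"
proof (rule LIMSEQ_I)
  fix e :: real assume e: "0 < e"
  have "0 < (1 - q) * (e / 2)" using e assms(3) by simp
  then have "\<forall>\<^sub>F n in sequentially. d n < (1 - q) * (e / 2)" using order_tendstoD(2)[OF assms(5)] by blast
  then obtain N where N: "\<And>n. N \<le> n \<Longrightarrow> d n < (1 - q) * (e / 2)"
    by (auto simp: eventually_sequentially)
  have bound: "x (N + j) \<le> e / 2 + q ^ j * x N" for j
  proof (induction j)
    case (Suc j)
    have "x (N + Suc j) \<le> d (N + j) + q * x (N + j)" using step[of "N + j"] by simp
    also have "\<dots> \<le> (1 - q) * (e / 2) + q * (e / 2 + q ^ j * x N)"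
      using N[of "N + j"] Suc assms(2) by (intro add_mono mult_left_mono) simp_all
    also have "\<dots> = e / 2 + q ^ Suc j * x N" by (simp add: field_simps)
    finally show ?case .
  qed (use e in simp)
  have "(\<lambda>j. q ^ j * x N) \<longlonglongrightarrow> 0 * x N"
    using assms(2,3) by (intro tendsto_mult LIMSEQ_realpow_zero tendsto_const) simp_all
  then have "\<forall>\<^sub>F j in sequentially. q ^ j * x N < e / 2"
    using e by (intro order_tendstoD) auto
  then obtain J where J: "\<And>j. J \<le> j \<Longrightarrow> q ^ j * x N < e / 2"
    by (auto simp: eventually_sequentially)
  have "norm (x n - 0) < e" if "N + J \<le> n" for n
  proof -
    have "J \<le> n - N" "N + (n - N) = n" using that by simp_all
    then show ?thesis using bound[of "n - N"] J[of "n - N"] assms(1)[of n] by simp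
  qed
  then show "\<exists>no. \<forall>n\<ge>no. norm (x n - 0) < e" by blast
qed

text \<open>The first index at which \<open>x\<close> exceeds its maximum over the indices up to
  \<open>N\<close> is a record.\<close>

lemma filterlim_at_top_records:
  fixes x :: "nat \<Rightarrow> real"
  assumes "filterlim x at_top sequentially"
  obtains n where "N \<le> n" and "\<And>j. j \<le> n \<Longrightarrow> x j \<le> x n"
proof -
  define M where "M = Max (x ` {..N})"
  have M: "x j \<le> M" if "j \<le> N" for j using that by (auto simp: M_def)
  have "\<exists>n. M < x n" using assms
    by (metis eventually_sequentially filterlim_at_top_dense le_refl)
  then obtain n where n: "M < x n" "\<And>j. j < n \<Longrightarrow> x j \<le> M"
    using exists_least_iff[of "\<lambda>n. M < x n"] by (auto simp: not_less)
  have "N \<le> n" using M[of n] n(1) by force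
  moreover have "x j \<le> x n" if "j \<le> n" for j
    using that n(1) n(2)[of j] by (cases "j = n") auto
  ultimately show thesis by (rule that)
qed

lemma bounded_sequence_cluster_point:
  fixes x :: "nat \<Rightarrow> 'a::euclidean_space"
  assumes "bounded (range x)"
  obtains r p where "strict_mono (r :: nat \<Rightarrow> nat)" and "(\<lambda>j. x (r j)) \<longlonglongrightarrow> p"
proof -
  have "compact (closure (range x))" using assms by simp
  moreover have "x n \<in> closure (range x)" for n using closure_subset[of "range x"] by auto
  ultimately obtain p r where "strict_mono r" "(x \<circ> r) \<longlonglongrightarrow> p"
    using seq_compactE[OF compact_imp_seq_compact, of "closure (range x)" x] by blast
  then show thesis using that by (simp add: o_def)
qed

text \<open>As \<open>S\<close> may have empty interior, a supporting hyperplane could contain all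
  of it. Supporting the closure at a point outside its relative interior, which is that of
  \<open>S\<close>, rules this out.\<close>

lemma proper_support_point:
  fixes S :: "'a::euclidean_space set"
  assumes "convex S" and "b \<in> closure S" and "b \<notin> S"
  obtains a where "\<And>x. x \<in> S \<Longrightarrow> 0 \<le> a \<bullet> (x - b)" and "\<exists>x\<in>S. 0 < a \<bullet> (x - b)"
proof -
  have ri: "rel_interior (closure S) = rel_interior S" using convex_rel_interior_closure[OF assms(1)] .
  have "b \<notin> rel_interior (closure S)" unfolding ri using assms(3) rel_interior_subset by blast
  then obtain a where a: "\<And>x. x \<in> closure S \<Longrightarrow> a \<bullet> b \<le> a \<bullet> x"
      "\<And>x. x \<in> rel_interior (closure S) \<Longrightarrow> a \<bullet> b < a \<bullet> x"
    using supporting_hyperplane_rel_boundary[OF convex_closure[OF assms(1)] assms(2)] by metis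
  have "S \<noteq> {}" using assms(2) by auto
  then have "rel_interior S \<noteq> {}" using rel_interior_eq_empty[OF assms(1)] by blast
  then obtain p where "p \<in> rel_interior S" by blast
  then have "p \<in> S" "a \<bullet> b < a \<bullet> p" using rel_interior_subset a(2) ri by auto
  then have "\<exists>x\<in>S. 0 < a \<bullet> (x - b)" by (auto simp: inner_diff_right)
  moreover have "0 \<le> a \<bullet> (x - b)" if "x \<in> S" for x
    using a(1)[of x] closure_subset that by (auto simp: inner_diff_right)
  ultimately show thesis using that by blast
qed

subsection \<open>The energy inequality\<close>

locale aGRAAL_run =
  fixes g :: "'a::euclidean_space \<Rightarrow> ereal" and F :: "'a \<Rightarrow> 'a" and phi lam_max :: real
    and z zb :: "nat \<Rightarrow> 'a" and lam theta :: "nat \<Rightarrow> real"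
  assumes proper_g: "proper g" and convex_g: "ereal_convex g" and lsc_g: "lower_semicontinuous g"
    and mono_F: "monotone_operator_on (effective_domain g) F"
    and lip_F: "locally_lipschitz_on (effective_domain g) F"
    and z0_dom: "z 0 \<in> effective_domain g" and z1_dom: "z 1 \<in> effective_domain g"
    and lam0_pos: "0 < lam 0" and phi_gt_1: "1 < phi" and phi_le: "phi \<le> (sqrt 5 + 1) / 2"
    and lam_max_pos: "0 < lam_max"
    and run: "aGRAAL g F phi lam_max z zb lam theta"
begin

abbreviation "D \<equiv> effective_domain g"

text \<open>Infinite values become 0 here, so \<open>G\<close> is meaningful only on
  \<open>D\<close>.\<close>

definition "G x = real_of_ereal (g x)"

lemma g_eq_G: "x \<in> D \<Longrightarrow> g x = ereal (G x)"
  unfolding G_def by (rule effective_domain_ereal_real[OF proper_g])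

lemma zb_0: "zb 0 = z 1" and theta_0: "theta 0 = 1"
  using run by (auto simp: aGRAAL_def)

lemma zb_average: "phi *\<^sub>R zb (Suc n) = (phi - 1) *\<^sub>R z (Suc n) + zb n"
proof -
  have "zb (Suc n) = ((phi - 1) *\<^sub>R z (Suc n) + zb n) /\<^sub>R phi"
    using run unfolding aGRAAL_def by (metis One_nat_def Suc_le_mono diff_Suc_1 le0)
  then show ?thesis using phi_gt_1 by simp
qed

lemma z_minus_zb: "z (Suc n) - zb n = phi *\<^sub>R (z (Suc n) - zb (Suc n))"
  using zb_average[of n] by (simp add: algebra_simps)

lemma z_prox: "z (Suc (Suc n)) = prox (lam (Suc n)) g (zb (Suc n) - lam (Suc n) *\<^sub>R F (z (Suc n)))"
  using run unfolding aGRAAL_def by (metis One_nat_def Suc_eq_plus1 Suc_le_mono le0)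

lemma theta_Suc: "theta (Suc n) = phi * (lam (Suc n) / lam n)"
  using run unfolding aGRAAL_def by (metis One_nat_def Suc_le_mono diff_Suc_1 le0)

lemma lam_Suc: "ereal (lam (Suc n)) =
    Min {ereal ((1 / phi + 1 / phi\<^sup>2) * lam n),
         ereal (phi * theta n / (4 * lam n)) *
           ext_quotient ((norm (z (Suc n) - z n))\<^sup>2) ((norm (F (z (Suc n)) - F (z n)))\<^sup>2),
         ereal lam_max}"
  using run unfolding aGRAAL_def by (metis One_nat_def Suc_le_mono diff_Suc_1 le0)

section \<open>Positivity and bounds of the step sizes and ratios\<close>

lemma lam_theta_pos: "0 < lam n \<and> 0 < theta n"
proof (induction n)
  case 0
  then show ?case using lam0_pos theta_0 by simp
next
  case (Suc n)
  let ?q = "ext_quotient ((norm (z (Suc n) - z n))\<^sup>2) ((norm (F (z (Suc n)) - F (z n)))\<^sup>2)"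
  let ?c = "phi * theta n / (4 * lam n)"
  have c: "0 < ?c" using Suc phi_gt_1 by simp
  have "0 < ereal ?c * ?q"
  proof (cases "F (z (Suc n)) = F (z n)")
    case True
    then show ?thesis using Suc phi_gt_1 by (simp add: ext_quotient_def)
  next
    case False
    \<comment> \<open>A zero numerator forces a zero denominator, where the quotient counts as
      infinite; so the middle term of the minimum is never zero.\<close>
    then have "z (Suc n) \<noteq> z n" by auto
    then show ?thesis using False Suc phi_gt_1 by (simp add: ext_quotient_def)
  qed
  moreover have "0 < 1 / phi + 1 / phi\<^sup>2" using phi_gt_1 by (simp add: add_pos_pos)
  ultimately have "0 < ereal (lam (Suc n))"
    unfolding lam_Suc using Suc lam_max_pos by simp
  then have "0 < lam (Suc n)" by simp
  then show ?case using Suc phi_gt_1 by (simp add: theta_Suc)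
qed

lemma lam_pos: "0 < lam n" and theta_pos: "0 < theta n"
  using lam_theta_pos by auto

lemma lam_Suc_le_max: "lam (Suc n) \<le> lam_max"
proof -
  have "ereal (lam (Suc n)) \<le> ereal lam_max" unfolding lam_Suc by (intro Min_le) auto
  then show ?thesis by simp
qed

text \<open>The growth cap of the step sizes times \<open>phi\<close> is \<open>1 + 1 / phi\<close>,
  the coefficient in \<open>averaging_energy_identity\<close>. This makes the second residual weight
  in \<open>energy_inequality\<close> nonnegative.\<close>

lemma theta_le: "theta n \<le> 1 + 1 / phi"
proof (cases n)
  case 0
  then show ?thesis using theta_0 phi_gt_1 by simp
next
  case (Suc m)
  have "ereal (lam (Suc m)) \<le> ereal ((1 / phi + 1 / phi\<^sup>2) * lam m)" unfolding lam_Suc by (intro Min_le) auto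
  then have "lam (Suc m) / lam m \<le> 1 / phi + 1 / phi\<^sup>2"
    using lam_pos[of m] by (simp add: pos_divide_le_eq)
  then have "phi * (lam (Suc m) / lam m) \<le> phi * (1 / phi + 1 / phi\<^sup>2)"
    using phi_gt_1 by (intro mult_left_mono) auto
  also have "\<dots> = 1 + 1 / phi" using phi_gt_1 by (simp add: field_simps power2_eq_square)
  finally show ?thesis by (simp add: Suc theta_Suc)
qed

lemma theta_le_2: "theta n \<le> 2"
proof -
  have "1 / phi \<le> 1" using phi_gt_1 by simp
  then show ?thesis using theta_le[of n] by linarith
qed

text \<open>Multiply the second term of the step size rule by \<open>lam (Suc n)\<close> and absorb
  \<open>phi * lam (Suc n) / lam n\<close> into \<open>theta (Suc n)\<close>. The two square roots
  let the product be split between consecutive energies.\<close>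

lemma lam_norm_F_diff_le:
  "lam (Suc n) * norm (F (z (Suc n)) - F (z n))
    \<le> sqrt (theta (Suc n)) * sqrt (theta n) / 2 * norm (z (Suc n) - z n)"
proof (cases "F (z (Suc n)) = F (z n)")
  case True
  then show ?thesis using theta_pos[of n] theta_pos[of "Suc n"] by simp
next
  case False
  define dF dz where "dF = norm (F (z (Suc n)) - F (z n))" and "dz = norm (z (Suc n) - z n)"
  have dF: "0 < dF" using False by (simp add: dF_def)
  have "ereal (lam (Suc n)) \<le> ereal (phi * theta n / (4 * lam n)) * ext_quotient (dz\<^sup>2) (dF\<^sup>2)"
    unfolding lam_Suc dF_def dz_def by (intro Min_le) auto
  then have "lam (Suc n) \<le> phi * theta n / (4 * lam n) * (dz\<^sup>2 / dF\<^sup>2)"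
    using dF by (simp add: ext_quotient_def)
  then have "lam (Suc n) * dF\<^sup>2 \<le> phi * theta n / (4 * lam n) * dz\<^sup>2"
    using dF lam_pos[of n] by (simp add: field_simps)
  then have "lam (Suc n) * (lam (Suc n) * dF\<^sup>2) \<le> lam (Suc n) * (phi * theta n / (4 * lam n) * dz\<^sup>2)"
    using lam_pos[of "Suc n"] by (intro mult_left_mono) auto
  also have "\<dots> = theta (Suc n) * theta n / 4 * dz\<^sup>2"
    by (simp add: theta_Suc field_simps)
  also have "\<dots> = (sqrt (theta (Suc n)) * sqrt (theta n) / 2 * dz)\<^sup>2"
    using theta_pos[of n] theta_pos[of "Suc n"]
    by (simp add: power_mult_distrib power_divide real_sqrt_mult[symmetric])
  finally have "(lam (Suc n) * dF)\<^sup>2 \<le> (sqrt (theta (Suc n)) * sqrt (theta n) / 2 * dz)\<^sup>2"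
    by (simp add: power2_eq_square ac_simps)
  then show ?thesis
    unfolding dF_def[symmetric] dz_def[symmetric]
    by (rule power2_le_imp_le) (use theta_pos[of n] theta_pos[of "Suc n"] in \<open>simp add: dz_def\<close>)
qed

text \<open>The bound on \<open>phi\<close> enters only here: it makes the growth factor of the step sizes at least one.\<close>

lemma lam_Suc_cases:
  obtains "lam n \<le> lam (Suc n)" | "lam (Suc n) = lam_max"
  | "F (z (Suc n)) \<noteq> F (z n)"
    "lam (Suc n) = phi * theta n / (4 * lam n) *
      ((norm (z (Suc n) - z n))\<^sup>2 / (norm (F (z (Suc n)) - F (z n)))\<^sup>2)"
proof -
  \<comment> \<open>This is \<open>phi\<^sup>2 \<le> phi + 1\<close>, the golden ratio inequality,
    with the square completed.\<close>
  have "(2 * phi - 1)\<^sup>2 \<le> (sqrt 5)\<^sup>2"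
    using phi_gt_1 phi_le by (intro power_mono) auto
  then have "phi\<^sup>2 \<le> phi + 1" by (simp add: power2_eq_square algebra_simps)
  then have "1 \<le> 1 / phi + 1 / phi\<^sup>2" using phi_gt_1 by (simp add: field_simps power2_eq_square)
  then have rho: "1 * lam n \<le> (1 / phi + 1 / phi\<^sup>2) * lam n"
    using lam_pos[of n] by (intro mult_right_mono) auto
  let ?a = "ereal ((1 / phi + 1 / phi\<^sup>2) * lam n)"
  let ?b = "ereal (phi * theta n / (4 * lam n)) *
           ext_quotient ((norm (z (Suc n) - z n))\<^sup>2) ((norm (F (z (Suc n)) - F (z n)))\<^sup>2)"
  have "Min {?a, ?b, ereal lam_max} \<in> {?a, ?b, ereal lam_max}" by (intro Min_in) auto
  then consider "ereal (lam (Suc n)) = ?a" | "ereal (lam (Suc n)) = ?b" | "ereal (lam (Suc n)) = ereal lam_max"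
    unfolding lam_Suc by blast
  then show thesis
  proof cases
    case 1
    then show thesis using that(1) rho by simp
  next
    case 2
    show thesis
    proof (cases "F (z (Suc n)) = F (z n)")
      case True
      then show thesis
        using 2 phi_gt_1 theta_pos[of n] lam_pos[of n] by (simp add: ext_quotient_def)
    next
      case False
      then show thesis using 2 that(3) by (simp add: ext_quotient_def)
    qed
  next
    case 3
    then show thesis using that(2) by simp
  qed
qed

section \<open>Inequalities along the iterates\<close>

lemma z_dom: "z n \<in> D"
proof -
  consider "n = 0" | "n = 1" | m where "n = Suc (Suc m)" by (metis One_nat_def not0_implies_Suc)
  then show ?thesis
  proof cases
    case 3
    then show ?thesis
      using z_prox prox_in_effective_domain[OF proper_g convex_g lsc_g lam_pos] by metis
  qed (use z0_dom z1_dom in auto)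
qed

lemma convex_D: "convex D"
  by (rule ereal_convex_effective_domain[OF proper_g convex_g])

lemma zb_dom: "zb n \<in> D"
proof (induction n)
  case 0
  then show ?case using z_dom by (simp add: zb_0)
next
  case (Suc n)
  have "zb (Suc n) = (1 / phi) *\<^sub>R (phi *\<^sub>R zb (Suc n))" using phi_gt_1 by simp
  also have "\<dots> = ((phi - 1) / phi) *\<^sub>R z (Suc n) + (1 / phi) *\<^sub>R zb n"
    unfolding zb_average by (simp add: scaleR_add_right)
  finally show ?case
    using convexD[OF convex_D z_dom Suc, of "(phi - 1) / phi" "1 / phi"] phi_gt_1
    by (simp add: field_simps)
qed

lemma F_monotone: "u \<in> D \<Longrightarrow> v \<in> D \<Longrightarrow> F v \<bullet> (u - v) \<le> F u \<bullet> (u - v)"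
  using mono_F by (auto simp: monotone_operator_on_def inner_diff_left)

lemma z_prox_inequality:
  assumes "w \<in> D"
  shows "lam (Suc n) * (G (z (Suc (Suc n))) - G w)
    \<le> (z (Suc (Suc n)) - zb (Suc n) + lam (Suc n) *\<^sub>R F (z (Suc n))) \<bullet> (w - z (Suc (Suc n)))"
  using prox_variational_inequality[OF proper_g convex_g lsc_g lam_pos[of "Suc n"] assms,
      of "zb (Suc n) - lam (Suc n) *\<^sub>R F (z (Suc n))"]
  unfolding z_prox[symmetric] G_def by (simp add: algebra_simps)

text \<open>Two prox inequalities are added: the one for \<open>z2\<close>, tested at
  \<open>w\<close>, and the preceding one, tested at \<open>z2\<close> and scaled by
  \<open>lam (Suc n) / lam n\<close>. Passing from \<open>zb n\<close> to \<open>zb (Suc n)\<close>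
  contributes a factor \<open>phi\<close>, so the scale becomes
  \<open>theta (Suc n)\<close>.\<close>

lemma two_step_inequality:
  assumes n: "1 \<le> n" and w: "w \<in> D"
  defines "z2 \<equiv> z (Suc (Suc n))" and "z1 \<equiv> z (Suc n)"
  shows "lam (Suc n) * (F z1 \<bullet> (z1 - w) + G z1 - G w)
    \<le> (z2 - zb (Suc n)) \<bullet> (w - z2) + theta (Suc n) * ((z1 - zb (Suc n)) \<bullet> (z2 - z1))
      + lam (Suc n) * (norm (F z1 - F (z n)) * norm (z2 - z1))"
proof -
  \<comment> \<open>For \<open>n = 0\<close> the point \<open>z (Suc n)\<close> would be an input
    and not the result of a prox step.\<close>
  obtain m where m: "n = Suc m" using n by (cases n) auto
  let ?l = "lam (Suc n)"
  have p2: "?l * (G z2 - G w) \<le> (z2 - zb (Suc n)) \<bullet> (w - z2) + ?l * (F z1 \<bullet> (w - z2))"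
    using z_prox_inequality[OF w, of n] by (simp add: z1_def z2_def inner_add_left)
  have "lam n * (G z1 - G z2) \<le> (z1 - zb n) \<bullet> (z2 - z1) + lam n * (F (z n) \<bullet> (z2 - z1))"
    using z_prox_inequality[of z2 m] z_dom by (simp add: m z1_def z2_def inner_add_left)
  then have "?l / lam n * (lam n * (G z1 - G z2))
      \<le> ?l / lam n * ((z1 - zb n) \<bullet> (z2 - z1) + lam n * (F (z n) \<bullet> (z2 - z1)))"
    using lam_pos[of n] lam_pos[of "Suc n"] by (intro mult_left_mono) auto
  moreover have "z1 - zb n = phi *\<^sub>R (z1 - zb (Suc n))" unfolding z1_def by (rule z_minus_zb)
  ultimately have p1: "?l * (G z1 - G z2)
      \<le> theta (Suc n) * ((z1 - zb (Suc n)) \<bullet> (z2 - z1)) + ?l * (F (z n) \<bullet> (z2 - z1))"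
    using lam_pos[of n] by (simp add: theta_Suc distrib_left ac_simps)
  have "- ((F z1 - F (z n)) \<bullet> (z2 - z1)) \<le> norm (F z1 - F (z n)) * norm (z2 - z1)"
    using norm_cauchy_schwarz[of "F (z n) - F z1" "z2 - z1"]
    by (simp add: norm_minus_commute inner_diff_left)
  then have "?l * - ((F z1 - F (z n)) \<bullet> (z2 - z1)) \<le> ?l * (norm (F z1 - F (z n)) * norm (z2 - z1))"
    using lam_pos[of "Suc n"] by (intro mult_left_mono) auto
  then show ?thesis using p1 p2
    by (simp add: inner_diff_left inner_diff_right algebra_simps)
qed

definition "E n w = phi / (phi - 1) * (norm (zb (Suc n) - w))\<^sup>2
  + theta n / 2 * (norm (z (Suc n) - z n))\<^sup>2"

text \<open>The expression of the variational inequality with base point \<open>w\<close> and test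
  point \<open>x\<close>. As \<open>F\<close> is taken at the fixed \<open>w\<close>, its blow-up
  near the boundary does no harm.\<close>

definition "psi w x = F w \<bullet> (x - w) + G x - G w"

text \<open>Monotonicity moves \<open>F\<close> from the iterate to \<open>w\<close>, the averaging
  identity telescopes, and polarization yields \<open>- theta (Suc n)\<close> times a squared step.
  Half of this, with the step term of \<open>E n w\<close>, pays for the change of \<open>F\<close>;
  the other half becomes the step term of \<open>E (Suc n) w\<close>.\<close>

lemma energy_inequality:
  assumes n: "1 \<le> n" and w: "w \<in> D"
  shows "E (Suc n) w + theta (Suc n) * (norm (z (Suc n) - zb (Suc n)))\<^sup>2
    + (1 + 1 / phi - theta (Suc n)) * (norm (z (Suc (Suc n)) - zb (Suc n)))\<^sup>2
    + 2 * lam (Suc n) * psi w (z (Suc n)) \<le> E n w"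
proof -
  define z2 z1 b t where "z2 = z (Suc (Suc n))" and "z1 = z (Suc n)" and "b = zb (Suc n)"
    and "t = theta (Suc n)"
  note defs = z2_def[symmetric] z1_def[symmetric] b_def[symmetric] t_def[symmetric]
  have "psi w z1 \<le> F z1 \<bullet> (z1 - w) + G z1 - G w"
    using F_monotone[OF z_dom[of "Suc n"] w] by (simp add: psi_def z1_def)
  then have "lam (Suc n) * psi w z1 \<le> lam (Suc n) * (F z1 \<bullet> (z1 - w) + G z1 - G w)"
    using lam_pos[of "Suc n"] by (intro mult_left_mono) auto
  also have "\<dots> \<le> (z2 - b) \<bullet> (w - z2) + t * ((z1 - b) \<bullet> (z2 - z1))
      + lam (Suc n) * (norm (F z1 - F (z n)) * norm (z2 - z1))"
    using two_step_inequality[OF n w] by (simp add: defs)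
  finally have 1: "2 * lam (Suc n) * psi w z1 \<le> 2 * ((z2 - b) \<bullet> (w - z2))
      + t * (2 * ((z1 - b) \<bullet> (z2 - z1)))
      + 2 * (lam (Suc n) * (norm (F z1 - F (z n)) * norm (z2 - z1)))" by simp
  have 2: "2 * ((z2 - b) \<bullet> (w - z2)) =
      phi / (phi - 1) * ((norm (b - w))\<^sup>2 - (norm (zb (Suc (Suc n)) - w))\<^sup>2)
      - (1 + 1 / phi) * (norm (z2 - b))\<^sup>2"
    unfolding z2_def b_def by (intro averaging_energy_identity phi_gt_1 zb_average)
  have 3: "2 * ((z1 - b) \<bullet> (z2 - z1)) = (norm (z2 - b))\<^sup>2 - (norm (z1 - b))\<^sup>2 - (norm (z2 - z1))\<^sup>2"
    unfolding power2_norm_eq_inner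
    by (simp add: inner_diff_left inner_diff_right inner_commute algebra_simps)
  define x y where "x = sqrt t * norm (z2 - z1)" and "y = sqrt (theta n) * norm (z1 - z n)"
  have "lam (Suc n) * norm (F z1 - F (z n)) * norm (z2 - z1)
      \<le> sqrt t * sqrt (theta n) / 2 * norm (z1 - z n) * norm (z2 - z1)"
    using lam_norm_F_diff_le[of n] by (intro mult_right_mono) (simp_all add: defs)
  then have "2 * (lam (Suc n) * (norm (F z1 - F (z n)) * norm (z2 - z1))) \<le> x * y"
    by (simp add: x_def y_def ac_simps)
  also have "\<dots> \<le> (x\<^sup>2 + y\<^sup>2) / 2"
    using sum_squares_bound[of x y] by simp
  also have "\<dots> = t / 2 * (norm (z2 - z1))\<^sup>2 + theta n / 2 * (norm (z1 - z n))\<^sup>2"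
    using theta_pos[of n] theta_pos[of "Suc n"]
    by (simp add: x_def y_def t_def power_mult_distrib field_simps)
  finally show ?thesis
    using 1 unfolding 2 3 E_def defs by (simp add: algebra_simps)
qed

lemma E_nonneg: "0 \<le> E n w"
  unfolding E_def using phi_gt_1 theta_pos[of n] by (intro add_nonneg_nonneg mult_nonneg_nonneg) auto

lemma norm_zb_le_E: "(norm (zb (Suc n) - w))\<^sup>2 \<le> E n w"
proof -
  have "1 * (norm (zb (Suc n) - w))\<^sup>2 \<le> phi / (phi - 1) * (norm (zb (Suc n) - w))\<^sup>2"
    using phi_gt_1 by (intro mult_right_mono) (auto simp: field_simps)
  moreover have "0 \<le> theta n / 2 * (norm (z (Suc n) - z n))\<^sup>2" using theta_pos[of n] by simp
  ultimately show ?thesis unfolding E_def by linarith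
qed

lemma E_Suc_le:
  assumes "1 \<le> n" and "w \<in> D"
  shows "E (Suc n) w + 2 * lam (Suc n) * psi w (z (Suc n)) \<le> E n w"
proof -
  have "0 \<le> theta (Suc n) * (norm (z (Suc n) - zb (Suc n)))\<^sup>2" using theta_pos[of "Suc n"] by simp
  moreover have "0 \<le> (1 + 1 / phi - theta (Suc n)) * (norm (z (Suc (Suc n)) - zb (Suc n)))\<^sup>2"
    using theta_le[of "Suc n"] by simp
  ultimately show ?thesis using energy_inequality[OF assms] by linarith
qed

lemma eventually_G_gt:
  assumes "b \<notin> D"
  obtains R where "0 < R" and "\<And>x. x \<in> D \<Longrightarrow> dist x b < R \<Longrightarrow> c < G x"
proof -
  have "ereal c < g b" using assms by (simp add: effective_domain_def)
  then have "\<forall>\<^sub>F y in nhds b. ereal c < g y" using lsc_g by (auto simp: lower_semicontinuous_def)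
  then obtain R where "0 < R" "\<forall>x. dist x b < R \<longrightarrow> ereal c < g x"
    by (auto simp: eventually_nhds_metric)
  then show thesis using that[of R] g_eq_G by (metis ereal_less_eq(3) less_ereal.simps(1))
qed

subsection \<open>Vanishing residuals\<close>

lemma psi_solution_nonneg:
  assumes "s \<in> VI_solutions g F" and "x \<in> D"
  shows "0 \<le> psi s x"
proof -
  have s: "s \<in> D" and "0 \<le> ereal (F s \<bullet> (x - s)) + g x - g s"
    using assms(1) by (auto simp: VI_solutions_def)
  then show ?thesis unfolding psi_def g_eq_G[OF s] g_eq_G[OF assms(2)] by simp
qed

lemma solution_dom: "s \<in> VI_solutions g F \<Longrightarrow> s \<in> D"
  by (simp add: VI_solutions_def)

lemma E_solution_convergent:
  assumes s: "s \<in> VI_solutions g F"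
  obtains l where "(\<lambda>n. E n s) \<longlonglongrightarrow> l" and "\<And>n. 1 \<le> n \<Longrightarrow> l \<le> E n s"
proof -
  have "E (Suc (Suc n)) s \<le> E (Suc n) s" for n
  proof -
    have "0 \<le> 2 * lam (Suc (Suc n)) * psi s (z (Suc (Suc n)))"
      using psi_solution_nonneg[OF s z_dom[of "Suc (Suc n)"]] lam_pos[of "Suc (Suc n)"] by simp
    then show ?thesis using E_Suc_le[of "Suc n" s] solution_dom[OF s] by simp
  qed
  then have dec: "decseq (\<lambda>n. E (Suc n) s)" by (intro decseq_SucI) auto
  then obtain l where l: "(\<lambda>n. E (Suc n) s) \<longlonglongrightarrow> l"
    using decseq_convergent[of "\<lambda>n. E (Suc n) s" 0] E_nonneg by blast
  have "l \<le> E n s" if "1 \<le> n" for n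
    using decseq_ge[OF dec l, of "n - 1"] that by simp
  then show thesis using that LIMSEQ_imp_Suc[OF l] by blast
qed

text \<open>As \<open>E n s\<close> converges, its decrements vanish, and they dominate both
  nonnegative residuals.\<close>

lemma residuals_tendsto_zero:
  assumes s: "s \<in> VI_solutions g F"
  shows "(\<lambda>n. theta (Suc n) * (norm (z (Suc n) - zb (Suc n)))\<^sup>2) \<longlonglongrightarrow> 0" (is "?A \<longlonglongrightarrow> 0")
    and "(\<lambda>n. (1 + 1 / phi - theta (Suc n)) * (norm (z (Suc (Suc n)) - zb (Suc n)))\<^sup>2) \<longlonglongrightarrow> 0"
      (is "?B \<longlonglongrightarrow> 0")
proof -
  obtain l where l: "(\<lambda>n. E n s) \<longlonglongrightarrow> l" using E_solution_convergent[OF s] by blast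
  have "(\<lambda>n. E n s - E (Suc n) s) \<longlonglongrightarrow> l - l"
    by (intro tendsto_diff l LIMSEQ_Suc[OF l])
  then have lim: "(\<lambda>n. E n s - E (Suc n) s) \<longlonglongrightarrow> 0" by simp
  have A: "0 \<le> ?A n" for n using theta_pos[of "Suc n"] by simp
  have B: "0 \<le> ?B n" for n using theta_le[of "Suc n"] by simp
  have AB: "?A n + ?B n \<le> E n s - E (Suc n) s" if "1 \<le> n" for n
  proof -
    have "0 \<le> 2 * lam (Suc n) * psi s (z (Suc n))"
      using psi_solution_nonneg[OF s z_dom[of "Suc n"]] lam_pos[of "Suc n"] by simp
    then show ?thesis using energy_inequality[OF that solution_dom[OF s]] by linarith
  qed
  have "\<forall>\<^sub>F n in sequentially. ?A n \<le> E n s - E (Suc n) s"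
    unfolding eventually_sequentially using AB B by (intro exI[of _ 1]) (smt (verit))
  then show "?A \<longlonglongrightarrow> 0"
    by (rule tendsto_sandwich[OF always_eventually _ tendsto_const lim, rotated]) (use A in blast)
  have "\<forall>\<^sub>F n in sequentially. ?B n \<le> E n s - E (Suc n) s"
    unfolding eventually_sequentially using AB A by (intro exI[of _ 1]) (smt (verit))
  then show "?B \<longlonglongrightarrow> 0"
    by (rule tendsto_sandwich[OF always_eventually _ tendsto_const lim, rotated]) (use B in blast)
qed

text \<open>The weight makes \<open>(y n)\<^sup>2 / 2\<close> the step term of the energy and the
  recursion in \<open>y_step\<close> linear.\<close>

definition "y n = sqrt (theta n) * norm (z (Suc n) - z n)"

lemma y_squared: "(y n)\<^sup>2 = theta n * (norm (z (Suc n) - z n))\<^sup>2"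
  using theta_pos[of n] by (simp add: y_def power_mult_distrib)

lemma E_eq: "E n w = phi / (phi - 1) * (norm (zb (Suc n) - w))\<^sup>2 + (y n)\<^sup>2 / 2"
  unfolding E_def y_squared by simp

text \<open>Taking \<open>w = z (Suc n)\<close> in \<open>two_step_inequality\<close> makes its left
  side zero, and one factor \<open>d\<close> cancels. After multiplication by \<open>sqrt t\<close>
  the previous \<open>y n\<close> carries the factor \<open>t / 2\<close>.\<close>

lemma y_step:
  assumes "1 \<le> n"
  shows "y (Suc n) \<le> sqrt (theta (Suc n)) * norm (z (Suc n) - zb (Suc n)) + (1 + 1 / phi) / 2 * y n"
proof -
  define z2 z1 b t where "z2 = z (Suc (Suc n))" and "z1 = z (Suc n)" and "b = zb (Suc n)"
    and "t = theta (Suc n)"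
  note defs = z2_def[symmetric] z1_def[symmetric] b_def[symmetric] t_def[symmetric]
  have t: "0 < t" "t \<le> 2" "t \<le> 1 + 1 / phi"
    using theta_pos theta_le_2 theta_le by (simp_all add: t_def)
  define d where "d = norm (z2 - z1)"
  have "0 \<le> (z2 - b) \<bullet> (z1 - z2) + t * ((z1 - b) \<bullet> (z2 - z1)) + lam (Suc n) * (norm (F z1 - F (z n)) * d)"
    using two_step_inequality[OF assms z_dom[of "Suc n"]] by (simp add: defs d_def)
  moreover have "(z2 - b) \<bullet> (z1 - z2) = - d\<^sup>2 - (z1 - b) \<bullet> (z2 - z1)"
    unfolding d_def power2_norm_eq_inner
    by (simp add: inner_diff_left inner_diff_right inner_commute)
  ultimately have "d\<^sup>2 \<le> (t - 1) * ((z1 - b) \<bullet> (z2 - z1)) + lam (Suc n) * norm (F z1 - F (z n)) * d"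
    by (simp add: algebra_simps)
  also have "(t - 1) * ((z1 - b) \<bullet> (z2 - z1)) \<le> \<bar>t - 1\<bar> * (norm (z1 - b) * d)"
  proof -
    have "(t - 1) * ((z1 - b) \<bullet> (z2 - z1)) \<le> \<bar>t - 1\<bar> * \<bar>(z1 - b) \<bullet> (z2 - z1)\<bar>"
      unfolding abs_mult[symmetric] by (rule abs_ge_self)
    also have "\<dots> \<le> \<bar>t - 1\<bar> * (norm (z1 - b) * d)"
      unfolding d_def by (intro mult_left_mono Cauchy_Schwarz_ineq2 abs_ge_zero)
    finally show ?thesis .
  qed
  also have "\<dots> \<le> 1 * (norm (z1 - b) * d)"
    using t by (intro mult_right_mono) (auto simp: d_def)
  also have "lam (Suc n) * norm (F z1 - F (z n)) * d \<le> sqrt t * sqrt (theta n) / 2 * norm (z1 - z n) * d"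
    using lam_norm_F_diff_le[of n] by (intro mult_right_mono) (simp_all add: defs d_def)
  finally have "d * d \<le> (norm (z1 - b) + sqrt t / 2 * y n) * d"
    by (simp add: power2_eq_square y_def defs algebra_simps)
  then have "d \<le> norm (z1 - b) + sqrt t / 2 * y n \<or> d = 0"
    using mult_right_le_imp_le[of d d "norm (z1 - b) + sqrt t / 2 * y n"] norm_ge_zero[of "z2 - z1"]
    by (auto simp: d_def)
  moreover have "0 \<le> norm (z1 - b) + sqrt t / 2 * y n"
    using t theta_pos[of n] by (simp add: y_def)
  ultimately have "d \<le> norm (z1 - b) + sqrt t / 2 * y n" by auto
  then have "sqrt t * d \<le> sqrt t * (norm (z1 - b) + sqrt t / 2 * y n)"
    using t by (intro mult_left_mono) auto
  also have "\<dots> = sqrt t * norm (z1 - b) + t / 2 * y n"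
    using t by (simp add: distrib_left flip: power2_eq_square)
  also have "t / 2 * y n \<le> (1 + 1 / phi) / 2 * y n"
    using t theta_pos[of n] by (intro mult_right_mono) (auto simp: y_def)
  finally show ?thesis unfolding y_def[of "Suc n"] defs d_def by simp
qed

text \<open>No lower bound on the step sizes is available at this point. The residuals nevertheless vanish:
  the contraction factor in \<open>y_step\<close> is below one, and the two weights in
  \<open>residuals_tendsto_zero\<close> add up to a positive constant.\<close>

lemma y_tendsto_zero:
  assumes "s \<in> VI_solutions g F"
  shows "y \<longlonglongrightarrow> 0"
proof -
  have "(\<lambda>n. sqrt (theta (Suc n) * (norm (z (Suc n) - zb (Suc n)))\<^sup>2)) \<longlonglongrightarrow> sqrt 0"
    by (intro tendsto_real_sqrt residuals_tendsto_zero(1)[OF assms])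
  then have "(\<lambda>n. sqrt (theta (Suc n)) * norm (z (Suc n) - zb (Suc n))) \<longlonglongrightarrow> 0"
    by (simp add: real_sqrt_mult)
  then have "(\<lambda>n. sqrt (theta (Suc (Suc n))) * norm (z (Suc (Suc n)) - zb (Suc (Suc n)))) \<longlonglongrightarrow> 0"
    by (rule LIMSEQ_Suc)
  then have "(\<lambda>n. y (Suc n)) \<longlonglongrightarrow> 0"
  proof (rule perturbed_contraction_tendsto_zero[rotated -1])
    show "0 \<le> y (Suc n)" for n using theta_pos[of "Suc n"] by (simp add: y_def)
    show "0 \<le> (1 + 1 / phi) / 2" "(1 + 1 / phi) / 2 < 1" using phi_gt_1 by auto
    show "y (Suc (Suc n)) \<le> sqrt (theta (Suc (Suc n))) * norm (z (Suc (Suc n)) - zb (Suc (Suc n)))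
        + (1 + 1 / phi) / 2 * y (Suc n)" for n
      using y_step[of "Suc n"] by simp
  qed
  then show ?thesis by (rule LIMSEQ_imp_Suc)
qed

lemma z_minus_zb_tendsto_zero:
  assumes s: "s \<in> VI_solutions g F"
  shows "(\<lambda>n. z n - zb n) \<longlonglongrightarrow> 0"
proof -
  let ?v = "\<lambda>n. (norm (z (Suc (Suc n)) - zb (Suc n)))\<^sup>2"
  let ?A = "\<lambda>n. theta (Suc n) * (norm (z (Suc n) - zb (Suc n)))\<^sup>2"
  let ?B = "\<lambda>n. (1 + 1 / phi - theta (Suc n)) * ?v n"
  have "(\<lambda>n. 2 * (y (Suc n))\<^sup>2) \<longlonglongrightarrow> 2 * 0\<^sup>2"
    by (intro tendsto_intros LIMSEQ_Suc[OF y_tendsto_zero[OF s]])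
  from tendsto_add[OF tendsto_add[OF this tendsto_mult[OF tendsto_const residuals_tendsto_zero(1)[OF s]]]
      residuals_tendsto_zero(2)[OF s], of 2]
  have lim: "(\<lambda>n. 2 * (y (Suc n))\<^sup>2 + 2 * ?A n + ?B n) \<longlonglongrightarrow> 0" by simp
  \<comment> \<open>\<open>theta\<close> may be small, so neither residual alone controls
    \<open>?v\<close>. The share of weight \<open>theta (Suc n)\<close> is bounded by the step and
    the first residual; the complementary share is the second residual.\<close>
  have bound: "?v n \<le> 2 * (y (Suc n))\<^sup>2 + 2 * ?A n + ?B n" for n
  proof -
    define p q where "p = z (Suc (Suc n)) - z (Suc n)" and "q = z (Suc n) - zb (Suc n)"
    have "0 \<le> (norm (p - q))\<^sup>2" by simp
    then have "(norm (p + q))\<^sup>2 \<le> 2 * (norm p)\<^sup>2 + 2 * (norm q)\<^sup>2"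
      unfolding power2_norm_eq_inner
      by (simp add: inner_diff_left inner_diff_right inner_add_left inner_add_right inner_commute)
    then have "theta (Suc n) * ?v n \<le> theta (Suc n) * (2 * (norm p)\<^sup>2 + 2 * (norm q)\<^sup>2)"
      using theta_pos[of "Suc n"] by (intro mult_left_mono) (auto simp: p_def q_def)
    also have "\<dots> = 2 * (y (Suc n))\<^sup>2 + 2 * ?A n"
      by (simp add: y_squared p_def q_def algebra_simps)
    finally have *: "theta (Suc n) * ?v n \<le> 2 * (y (Suc n))\<^sup>2 + 2 * ?A n" .
    have "1 * ?v n \<le> (1 + 1 / phi) * ?v n" using phi_gt_1 by (intro mult_right_mono) auto
    also have "\<dots> = theta (Suc n) * ?v n + ?B n" by (simp add: algebra_simps)
    finally show ?thesis using * by simp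
  qed
  have "?v \<longlonglongrightarrow> 0"
    by (rule tendsto_sandwich[OF always_eventually always_eventually tendsto_const lim])
      (use bound in auto)
  then have "(\<lambda>n. norm (z (Suc (Suc n)) - zb (Suc n))) \<longlonglongrightarrow> 0"
    using tendsto_real_sqrt[of ?v 0] by simp
  then have "(\<lambda>n. phi *\<^sub>R (z (Suc (Suc n)) - zb (Suc (Suc n)))) \<longlonglongrightarrow> 0"
    by (simp only: tendsto_norm_zero_iff z_minus_zb)
  then have "(\<lambda>n. (1 / phi) *\<^sub>R (phi *\<^sub>R (z (Suc (Suc n)) - zb (Suc (Suc n))))) \<longlonglongrightarrow> (1 / phi) *\<^sub>R 0"
    by (intro tendsto_intros)
  then have "(\<lambda>n. z (Suc (Suc n)) - zb (Suc (Suc n))) \<longlonglongrightarrow> 0" using phi_gt_1 by simp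
  then show ?thesis
    by (intro LIMSEQ_imp_Suc[of "\<lambda>n. z n - zb n"] LIMSEQ_imp_Suc[of "\<lambda>n. z (Suc n) - zb (Suc n)"])
qed

lemma z_Suc_minus_zb_tendsto_zero:
  assumes s: "s \<in> VI_solutions g F"
  shows "(\<lambda>n. z (Suc n) - zb n) \<longlonglongrightarrow> 0"
proof -
  have "(\<lambda>n. phi *\<^sub>R (z (Suc n) - zb (Suc n))) \<longlonglongrightarrow> phi *\<^sub>R 0"
    by (intro tendsto_scaleR tendsto_const LIMSEQ_Suc[OF z_minus_zb_tendsto_zero[OF s]])
  then show ?thesis by (simp add: z_minus_zb)
qed

lemma z_diff_tendsto_zero:
  assumes s: "s \<in> VI_solutions g F"
  shows "(\<lambda>n. z (Suc n) - z n) \<longlonglongrightarrow> 0"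
  using tendsto_diff[OF z_Suc_minus_zb_tendsto_zero[OF s] z_minus_zb_tendsto_zero[OF s]] by simp

lemma bounded_z:
  assumes s: "s \<in> VI_solutions g F"
  shows "bounded (range z)"
proof -
  obtain l where "(\<lambda>n. E n s) \<longlonglongrightarrow> l" using E_solution_convergent[OF s] by blast
  then have "Bseq (\<lambda>n. E n s)" by (rule convergent_imp_Bseq[OF convergentI])
  then obtain K where K: "\<And>n. norm (E n s) \<le> K" unfolding Bseq_def by blast
  have K0: "0 \<le> K" using K[of 0] by (smt (verit) norm_ge_zero)
  have "norm (zb (Suc n)) \<le> norm s + sqrt K" for n
  proof -
    have "(norm (zb (Suc n) - s))\<^sup>2 \<le> K" using norm_zb_le_E[of n s] K[of n] by simp
    then have "norm (zb (Suc n) - s) \<le> sqrt K" by (simp add: real_le_rsqrt)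
    then show ?thesis using norm_triangle_ineq2[of "zb (Suc n)" s] by linarith
  qed
  then have "Bseq (\<lambda>n. zb (Suc n))" by (rule BseqI')
  then have "Bseq zb" by (simp add: Bseq_Suc_iff)
  then obtain A where A: "\<And>n. norm (zb n) \<le> A" unfolding Bseq_def by blast
  have "Bseq (\<lambda>n. z n - zb n)"
    by (rule convergent_imp_Bseq[OF convergentI[OF z_minus_zb_tendsto_zero[OF s]]])
  then obtain B where B: "\<And>n. norm (z n - zb n) \<le> B" unfolding Bseq_def by blast
  have "norm (z n) \<le> A + B" for n
    using norm_triangle_ineq[of "zb n" "z n - zb n"] A[of n] B[of n] by simp
  then show ?thesis unfolding bounded_iff by blast
qed

subsection \<open>Cluster points lie in the domain\<close>

text \<open>Near a point \<open>b\<close> outside the domain, \<open>g\<close> is so large that each step lowers \<open>E n s\<close> by at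
  least \<open>2 * lam n\<close>, while \<open>E n w\<close>, for a point \<open>w\<close> of the domain close to \<open>b\<close>, grows by at most a
  constant multiple of this. As \<open>E n s\<close> converges, the iterates cannot leave the neighbourhood.\<close>

lemma cluster_point_outside_dom_is_limit:
  assumes s: "s \<in> VI_solutions g F" and r: "filterlim r at_top sequentially"
    and zr: "(\<lambda>j. z (r j)) \<longlonglongrightarrow> b" and b: "b \<notin> D"
  shows "z \<longlonglongrightarrow> b"
proof (rule metric_LIMSEQ_I)
  fix eps :: real assume eps: "0 < eps"
  \<comment> \<open>Within distance 1 of \<open>b\<close> the term with \<open>F s\<close> is at
    least \<open>- norm (F s) * (norm (b - s) + 1)\<close>, so \<open>G x > c\<close> gives
    \<open>psi s x \<ge> 1\<close>.\<close>
  define c where "c = G s + norm (F s) * (norm (b - s) + 1) + 1"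
  obtain R0 where R0: "0 < R0" "\<And>x. x \<in> D \<Longrightarrow> dist x b < R0 \<Longrightarrow> c < G x"
    using eventually_G_gt[OF b] by blast
  define R where "R = min R0 (min eps 1)"
  have R: "0 < R" "R \<le> 1" "R \<le> eps" "R \<le> R0" using R0(1) eps by (auto simp: R_def)
  have G_R: "c < G x" if "x \<in> D" "dist x b < R" for x using R0(2) that R(4) by simp
  have inner_ge: "- (norm (F v) * A) \<le> F v \<bullet> u" if "norm u \<le> A" for u v A
    using Cauchy_Schwarz_ineq2[of "F v" u] mult_left_mono[OF that norm_ge_zero[of "F v"]] by linarith
  have psi_s: "1 \<le> psi s x" if "x \<in> D" "dist x b < R" for x
  proof -
    have "norm (x - s) \<le> norm (b - s) + 1"
      using norm_triangle_ineq[of "x - b" "b - s"] that(2) R(2) by (simp add: dist_norm)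
    then show ?thesis using inner_ge[of "x - s" _ s] G_R[OF that] by (fastforce simp: psi_def c_def)
  qed
  have "\<forall>\<^sub>F j in sequentially. dist (z (r j)) b < R / 8"
    using zr R(1) by (intro tendstoD) auto
  then obtain j0 where "dist (z (r j0)) b < R / 8" by (auto simp: eventually_sequentially)
  then obtain w where w: "w \<in> D" "dist w b < R / 8" using z_dom by blast
  \<comment> \<open>\<open>C\<close> bounds the possible loss in \<open>psi w\<close> near
    \<open>b\<close>, where \<open>norm (x - w) \<le> 2\<close> and \<open>G x > c\<close>.\<close>
  define C where "C = norm (F w) * 2 + \<bar>c\<bar> + \<bar>G w\<bar>"
  have C: "0 \<le> C" by (simp add: C_def)
  have psi_w: "- C \<le> psi w x" if "x \<in> D" "dist x b < R" for x
  proof -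
    have "norm (x - w) \<le> 2"
      using dist_triangle2[of x w b] that(2) w(2) R(2) by (simp add: dist_norm)
    then show ?thesis using inner_ge[of "x - w" 2 w] G_R[OF that] by (simp add: psi_def C_def)
  qed
  obtain l where l: "(\<lambda>n. E n s) \<longlonglongrightarrow> l" "\<And>n. 1 \<le> n \<Longrightarrow> l \<le> E n s"
    using E_solution_convergent[OF s] by blast
  have "(\<lambda>n. C * (E n s - l) + (y n)\<^sup>2 / 2) \<longlonglongrightarrow> C * (l - l) + 0\<^sup>2 / 2"
    by (intro tendsto_intros l y_tendsto_zero[OF s]) simp
  then have "\<forall>\<^sub>F n in sequentially. C * (E n s - l) + (y n)\<^sup>2 / 2 < R\<^sup>2 / 64"
    using R(1) by (intro order_tendstoD(2)) auto
  moreover have "\<forall>\<^sub>F n in sequentially. dist (z n - zb n) 0 < R / 8"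
    using R(1) by (intro tendstoD z_minus_zb_tendsto_zero[OF s]) auto
  ultimately have "\<forall>\<^sub>F n in sequentially. C * (E n s - l) + (y n)\<^sup>2 / 2 < R\<^sup>2 / 64
      \<and> dist (z n - zb n) 0 < R / 8" by (rule eventually_conj)
  then obtain N where N: "\<And>n. N \<le> n \<Longrightarrow> C * (E n s - l) + (y n)\<^sup>2 / 2 < R\<^sup>2 / 64"
      "\<And>n. N \<le> n \<Longrightarrow> norm (z n - zb n) < R / 8"
    unfolding eventually_sequentially by auto
  have "\<forall>\<^sub>F j in sequentially. N + 2 \<le> r j" using r by (simp add: filterlim_at_top)
  moreover have "\<forall>\<^sub>F j in sequentially. dist (z (r j)) b < R / 8"
    using zr R(1) by (intro tendstoD) auto
  ultimately have "\<forall>\<^sub>F j in sequentially. N + 2 \<le> r j \<and> dist (z (r j)) b < R / 8"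
    by eventually_elim auto
  then obtain j where j: "N + 2 \<le> r j" "dist (z (r j)) b < R / 8" by (auto simp: eventually_sequentially)
  \<comment> \<open>Shifted by one because \<open>E n0 w\<close> involves the points of index
    \<open>Suc n0\<close>.\<close>
  define n0 where "n0 = r j - 1"
  have n0: "N \<le> n0" "1 \<le> n0" "dist (z (Suc n0)) b < R / 8" using j by (auto simp: n0_def)
  define k where "k = phi / (phi - 1)"
  have k: "1 \<le> k" using phi_gt_1 by (simp add: k_def field_simps)
  \<comment> \<open>\<open>C\<close> times \<open>psi s \<ge> 1\<close> offsets
    \<open>psi w \<ge> - C\<close>, so \<open>H\<close> cannot increase while the iterates stay
    within \<open>R\<close> of \<open>b\<close>.\<close>
  define H where "H n = E n w + C * E n s" for n
  \<comment> \<open>Budget: \<open>zb (Suc n0)\<close> is within \<open>3 * R / 8\<close> of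
    \<open>w\<close>; the bound on \<open>H\<close> keeps \<open>zb (Suc n)\<close> within
    \<open>R / 2\<close> of \<open>w\<close>, hence \<open>z (Suc n)\<close> within
    \<open>R / 8 + R / 2 + R / 8\<close> of \<open>b\<close>.\<close>
  have near: "dist (z (Suc n)) b < R" if "n0 \<le> n" "H n \<le> H n0" for n
  proof -
    have "dist (zb (Suc n0)) w \<le> dist (zb (Suc n0)) (z (Suc n0)) + (dist (z (Suc n0)) b + dist b w)"
      by (intro order_trans[OF dist_triangle[of _ _ "z (Suc n0)"]] add_left_mono dist_triangle)
    moreover have "dist (zb (Suc n0)) (z (Suc n0)) < R / 8"
      using N(2)[of "Suc n0"] n0(1) by (simp add: dist_norm norm_minus_commute)
    ultimately have "norm (zb (Suc n0) - w) \<le> 3 * R / 8"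
      using n0(3) w(2) by (simp add: dist_norm norm_minus_commute)
    then have "(norm (zb (Suc n0) - w))\<^sup>2 \<le> (3 * R / 8)\<^sup>2" by (intro power_mono) auto
    then have a: "k * (norm (zb (Suc n0) - w))\<^sup>2 \<le> k * (9 * R\<^sup>2 / 64)"
      using k by (intro mult_left_mono) (auto simp: power2_eq_square)
    have "C * l \<le> C * E n s" using C l(2)[of n] that(1) n0(2) by (intro mult_left_mono) auto
    moreover have "k * (norm (zb (Suc n) - w))\<^sup>2 \<le> E n w" by (simp add: E_eq k_def)
    ultimately have "k * (norm (zb (Suc n) - w))\<^sup>2 \<le> E n0 w + C * (E n0 s - l)"
      using that(2) by (simp add: H_def algebra_simps)
    also have "\<dots> \<le> k * (9 * R\<^sup>2 / 64) + R\<^sup>2 / 64"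
      using N(1)[OF n0(1)] a unfolding E_eq k_def by linarith
    also have "\<dots> \<le> k * (9 * R\<^sup>2 / 64) + k * (R\<^sup>2 / 64)"
      using mult_right_mono[OF k, of "R\<^sup>2 / 64"] by simp
    also have "\<dots> = k * (9 * R\<^sup>2 / 64 + R\<^sup>2 / 64)" by (rule distrib_left[symmetric])
    also have "\<dots> \<le> k * (R / 2)\<^sup>2"
      using k by (intro mult_left_mono) (auto simp: power2_eq_square)
    finally have "(norm (zb (Suc n) - w))\<^sup>2 \<le> (R / 2)\<^sup>2" using k by (simp add: mult_le_cancel_left)
    then have "norm (zb (Suc n) - w) \<le> R / 2" by (rule power2_le_imp_le) (use R(1) in simp)
    moreover have "dist (z (Suc n)) b \<le> norm (z (Suc n) - zb (Suc n)) + (norm (zb (Suc n) - w) + dist w b)"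
      unfolding dist_norm[symmetric]
      by (intro order_trans[OF dist_triangle[of _ _ "zb (Suc n)"]] add_left_mono dist_triangle)
    ultimately show ?thesis using N(2)[of "Suc n"] that(1) n0(1) w(2) R(1) by simp
  qed
  \<comment> \<open>Bootstrap: the bound on \<open>H n\<close> places \<open>z (Suc n)\<close> near
    \<open>b\<close>, which in turn yields \<open>H (Suc n) \<le> H n\<close>.\<close>
  have "H n \<le> H n0" if "n0 \<le> n" for n using that
  proof (induction n rule: dec_induct)
    case (step n)
    note x = z_dom[of "Suc n"] near[OF step(1,3)]
    have n: "1 \<le> n" using step(1) n0(2) by simp
    define m where "m = 2 * lam (Suc n)"
    have m: "0 < m" using lam_pos[of "Suc n"] by (simp add: m_def)
    have "0 \<le> psi w (z (Suc n)) + C * psi s (z (Suc n))"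
      using psi_w[OF x] mult_left_mono[OF psi_s[OF x] C] by linarith
    then have "0 \<le> m * psi w (z (Suc n)) + C * (m * psi s (z (Suc n)))"
      using m mult_nonneg_nonneg[of m "psi w (z (Suc n)) + C * psi s (z (Suc n))"]
      by (simp add: algebra_simps)
    moreover have "E (Suc n) w + m * psi w (z (Suc n)) \<le> E n w"
      unfolding m_def by (rule E_Suc_le[OF n w(1)])
    moreover have "C * (E (Suc n) s + m * psi s (z (Suc n))) \<le> C * E n s"
      unfolding m_def by (intro mult_left_mono C E_Suc_le[OF n solution_dom[OF s]])
    ultimately have "H (Suc n) \<le> H n" by (simp add: H_def algebra_simps)
    then show ?case using step(3) by simp
  qed simp
  then have "dist (z (Suc n)) b < eps" if "n0 \<le> n" for n
    using near[OF that] that R(3) by fastforce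
  then have "dist (z n) b < eps" if "Suc n0 \<le> n" for n
    using that by (metis Suc_le_D Suc_le_mono)
  then show "\<exists>no. \<forall>n\<ge>no. dist (z n) b < eps" by blast
qed

section \<open>Excluding a limit outside the domain\<close>

lemma z_minus_eq: "(phi - 1) *\<^sub>R (z (Suc n) - b) = phi *\<^sub>R (zb (Suc n) - b) - (zb n - b)"
  using zb_average[of n] by (simp add: algebra_simps)

lemma norm_z_minus_le:
  "norm (z (Suc n) - b) \<le> (phi * norm (zb (Suc n) - b) + norm (zb n - b)) / (phi - 1)"
proof -
  have "(phi - 1) * norm (z (Suc n) - b) = norm ((phi - 1) *\<^sub>R (z (Suc n) - b))"
    using phi_gt_1 by simp
  also have "\<dots> \<le> norm (phi *\<^sub>R (zb (Suc n) - b)) + norm (zb n - b)"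
    unfolding z_minus_eq by (rule norm_triangle_ineq4)
  also have "norm (phi *\<^sub>R (zb (Suc n) - b)) = phi * norm (zb (Suc n) - b)"
    using phi_gt_1 by simp
  finally show ?thesis using phi_gt_1 by (simp add: pos_le_divide_eq mult.commute)
qed

text \<open>A supporting functional \<open>a\<close> at \<open>b\<close> is nonnegative along the iterates, so the averaging rule
  keeps \<open>a \<bullet> (zb n - b)\<close> above a geometric sequence.\<close>

lemma zb_convergence_at_most_geometric:
  assumes lim: "zb \<longlonglongrightarrow> b" and b: "b \<notin> D"
  obtains c K where "0 < c" and "\<And>n. K \<le> n \<Longrightarrow> c \<le> phi ^ n * norm (zb n - b)"
proof -
  \<comment> \<open>A functional supporting \<open>D\<close> at \<open>b\<close> could be constant
    along the iterates. Properly supporting their hull instead makes some \<open>h K\<close>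
    positive.\<close>
  define S where "S = convex hull (range zb \<union> range (\<lambda>n. z (Suc n)))"
  have "S \<subseteq> D" unfolding S_def
    by (rule hull_minimal) (use zb_dom z_dom convex_D in auto)
  have zbS: "zb n \<in> S" and zS: "z (Suc n) \<in> S" for n
    unfolding S_def by (auto intro: hull_inc)
  have "b \<in> closure S" using lim zbS by (auto simp: closure_sequential)
  moreover have "b \<notin> S" using b \<open>S \<subseteq> D\<close> by blast
  moreover have "convex S" by (simp add: S_def)
  ultimately obtain a where a: "\<And>x. x \<in> S \<Longrightarrow> 0 \<le> a \<bullet> (x - b)" "\<exists>x\<in>S. 0 < a \<bullet> (x - b)"
    using proper_support_point[of S b] by blast
  define h where "h n = a \<bullet> (zb n - b)" for n
  have avg: "(phi - 1) * (a \<bullet> (z (Suc n) - b)) = phi * h (Suc n) - h n" for n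
    using arg_cong[OF z_minus_eq, of "inner a" n b] by (simp add: h_def inner_diff_right)
  have h_step: "h n \<le> phi * h (Suc n)" for n
  proof -
    have "0 \<le> (phi - 1) * (a \<bullet> (z (Suc n) - b))" using a(1)[OF zS[of n]] phi_gt_1 by simp
    then show ?thesis using avg[of n] by simp
  qed
  have "\<exists>K. 0 < h K"
  proof (rule ccontr)
    assume "\<nexists>K. 0 < h K"
    then have h0: "h n = 0" for n using a(1)[OF zbS[of n]] by (auto simp: h_def not_less order_antisym)
    have "a \<bullet> (z (Suc n) - b) = 0" for n using avg[of n] phi_gt_1 by (simp add: h0)
    then have "S \<subseteq> {x. a \<bullet> x = a \<bullet> b}" unfolding S_def
      using h0 by (intro hull_minimal convex_hyperplane) (auto simp: h_def inner_diff_right)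
    then show False using a(2) by (auto simp: inner_diff_right)
  qed
  then obtain K where K: "0 < h K" by blast
  have grow: "h K \<le> phi ^ j * h (K + j)" for j
  proof (induction j)
    case (Suc j)
    have "phi ^ j * h (K + j) \<le> phi ^ j * (phi * h (K + Suc j))"
      using h_step[of "K + j"] phi_gt_1 by (intro mult_left_mono) auto
    then show ?case using Suc by (simp add: ac_simps)
  qed simp
  have na: "0 < norm a" using K by (auto simp: h_def)
  have "h K / norm a \<le> phi ^ n * norm (zb n - b)" if "K \<le> n" for n
  proof -
    have "h n \<le> norm a * norm (zb n - b)" unfolding h_def by (rule norm_cauchy_schwarz)
    then have "phi ^ (n - K) * h n \<le> phi ^ (n - K) * (norm a * norm (zb n - b))"
      using phi_gt_1 by (intro mult_left_mono) auto
    also have "\<dots> \<le> phi ^ n * (norm a * norm (zb n - b))"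
      using phi_gt_1 by (intro mult_right_mono power_increasing) auto
    finally have "h K \<le> phi ^ n * (norm a * norm (zb n - b))" using grow[of "n - K"] that by simp
    then show ?thesis using na by (simp add: pos_divide_le_eq ac_simps)
  qed
  then show thesis using that[of "h K / norm a" K] K na by simp
qed

text \<open>The distance of \<open>zb n\<close> to \<open>b\<close> decays at most like
  \<open>1 / phi ^ n\<close>, so weighted by \<open>(phi\<^sup>2) ^ n\<close> it diverges and has
  arbitrarily late records. At a record the two preceding distances are bounded by multiples of the
  current one, and these three control two consecutive iterates.\<close>

lemma frequently_step_le_distance:
  assumes lim: "zb \<longlonglongrightarrow> b" and b: "b \<notin> D"
  obtains Q r where "strict_mono (r :: nat \<Rightarrow> nat)"
    and "\<And>j. norm (z (Suc (r j)) - z (r j)) \<le> Q * norm (zb (Suc (r j)) - b)"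
proof -
  define e where "e n = norm (zb n - b)" for n
  define x where "x n = (phi\<^sup>2) ^ n * e n" for n
  obtain c K where c: "0 < c" "\<And>n. K \<le> n \<Longrightarrow> c \<le> phi ^ n * e n"
    using zb_convergence_at_most_geometric[OF lim b] unfolding e_def by blast
  have "filterlim (\<lambda>n. phi ^ n) at_top sequentially"
    using phi_gt_1
    by (intro filterlim_at_infinity_imp_filterlim_at_top filterlim_realpow_sequentially_gt1) auto
  then have "filterlim (\<lambda>n. c * phi ^ n) at_top sequentially"
    by (rule filterlim_tendsto_pos_mult_at_top[OF tendsto_const c(1)])
  moreover have "\<forall>\<^sub>F n in sequentially. c * phi ^ n \<le> x n"
    using eventually_ge_at_top[of K]
  proof eventually_elim
    case (elim n)
    have "c * phi ^ n \<le> (phi ^ n * e n) * phi ^ n"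
      using c(2)[OF elim] phi_gt_1 by (intro mult_right_mono) auto
    then show ?case by (simp add: x_def power2_eq_square power_mult_distrib ac_simps)
  qed
  ultimately have x_top: "filterlim x at_top sequentially" by (rule filterlim_at_top_mono)
  \<comment> \<open>The two fractions bound the distances to \<open>b\<close> of the iterates with
    indices \<open>m\<close> and \<open>m - 1\<close>, in units of \<open>e m\<close>, at a record
    \<open>m\<close>.\<close>
  define Q where "Q = (phi + phi\<^sup>2) / (phi - 1) + (phi * phi\<^sup>2 + (phi\<^sup>2)\<^sup>2) / (phi - 1)"
  have rec: "\<exists>n\<ge>N. norm (z (Suc n) - z n) \<le> Q * e (Suc n)" for N
  proof -
    obtain m where m: "Suc (Suc N) \<le> m" "\<And>j. j \<le> m \<Longrightarrow> x j \<le> x m"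
      using filterlim_at_top_records[OF x_top, of "Suc (Suc N)"] by blast
    obtain n where n: "m = Suc (Suc n)" "N \<le> n" using m(1) by (metis Suc_le_D Suc_le_mono)
    have pos: "0 < (phi\<^sup>2) ^ n" using phi_gt_1 by simp
    have e1: "e (Suc n) \<le> phi\<^sup>2 * e m" and e0: "e n \<le> (phi\<^sup>2)\<^sup>2 * e m"
      using m(2)[of "Suc n"] m(2)[of n] pos phi_gt_1 unfolding x_def n(1)
      by (simp_all add: power2_eq_square ac_simps)
    have "norm (z m - b) \<le> (phi * e m + e (Suc n)) / (phi - 1)"
      using norm_z_minus_le[of "Suc n" b] by (simp add: e_def n(1))
    also have "\<dots> \<le> (phi * e m + phi\<^sup>2 * e m) / (phi - 1)"
      using e1 phi_gt_1 by (intro divide_right_mono) auto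
    finally have 1: "norm (z m - b) \<le> (phi * e m + phi\<^sup>2 * e m) / (phi - 1)" .
    have "norm (z (Suc n) - b) \<le> (phi * e (Suc n) + e n) / (phi - 1)"
      using norm_z_minus_le[of n b] by (simp add: e_def)
    also have "\<dots> \<le> (phi * (phi\<^sup>2 * e m) + (phi\<^sup>2)\<^sup>2 * e m) / (phi - 1)"
      using e0 e1 phi_gt_1 by (intro divide_right_mono add_mono mult_left_mono) auto
    finally have 2: "norm (z (Suc n) - b) \<le> (phi * (phi\<^sup>2 * e m) + (phi\<^sup>2)\<^sup>2 * e m) / (phi - 1)" .
    have "norm (z m - z (Suc n)) \<le> norm (z m - b) + norm (z (Suc n) - b)"
      using norm_triangle_ineq4[of "z m - b" "z (Suc n) - b"] by simp
    also have "\<dots> \<le> (phi * e m + phi\<^sup>2 * e m) / (phi - 1)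
        + (phi * (phi\<^sup>2 * e m) + (phi\<^sup>2)\<^sup>2 * e m) / (phi - 1)" by (rule add_mono[OF 1 2])
    also have "\<dots> = Q * e m"
      by (simp add: Q_def add_divide_distrib distrib_right)
    finally show ?thesis using n by (intro exI[of _ "Suc n"]) simp
  qed
  then have "infinite {n. norm (z (Suc n) - z n) \<le> Q * e (Suc n)}"
    unfolding infinite_nat_iff_unbounded_le by simp
  then obtain r :: "nat \<Rightarrow> nat" where "strict_mono r" "\<And>j. r j \<in> {n. norm (z (Suc n) - z n) \<le> Q * e (Suc n)}"
    using infinite_enumerate by blast
  then show thesis using that[of r Q] by (simp add: e_def)
qed

text \<open>If the limit \<open>b\<close> were outside the domain, then \<open>E n w\<close> would eventually decrease for \<^emph>\<open>every\<close>
  \<open>w\<close> in the domain. A limiting unit direction of \<open>zb n - b\<close> would then make a nonpositive inner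
  product with all \<open>w - b\<close>, in particular with all \<open>zb n - b\<close>, hence with itself.\<close>

lemma limit_in_dom:
  assumes s: "s \<in> VI_solutions g F" and lim: "z \<longlonglongrightarrow> b"
  shows "b \<in> D"
proof (rule ccontr)
  assume b: "b \<notin> D"
  have limb: "zb \<longlonglongrightarrow> b"
    using tendsto_diff[OF lim z_minus_zb_tendsto_zero[OF s]] by simp
  define k where "k = phi / (phi - 1)"
  have k: "1 \<le> k" using phi_gt_1 by (simp add: k_def field_simps)
  have E_lim: "(\<lambda>n. E n w) \<longlonglongrightarrow> k * (norm (b - w))\<^sup>2" for w
  proof -
    have "(\<lambda>n. k * (norm (zb (Suc n) - w))\<^sup>2 + (y n)\<^sup>2 / 2) \<longlonglongrightarrow> k * (norm (b - w))\<^sup>2 + 0\<^sup>2 / 2"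
      by (intro tendsto_intros y_tendsto_zero[OF s] LIMSEQ_Suc[OF limb]) simp
    then show ?thesis by (simp add: E_eq k_def)
  qed
  \<comment> \<open>Near \<open>b\<close> the large values of \<open>G\<close> make
    \<open>psi w\<close> nonnegative, so \<open>E n w\<close> decreases to its limit.\<close>
  have E_ge: "\<forall>\<^sub>F n in sequentially. k * (norm (b - w))\<^sup>2 \<le> E n w" if w: "w \<in> D" for w
  proof -
    obtain R where R: "0 < R" "\<And>x. x \<in> D \<Longrightarrow> dist x b < R \<Longrightarrow> G w + norm (F w) * (norm (b - w) + 1) < G x"
      using eventually_G_gt[OF b] by blast
    have "\<forall>\<^sub>F n in sequentially. dist (z n) b < min R 1"
      using lim R(1) by (intro tendstoD) auto
    then obtain N where N: "\<And>n. N \<le> n \<Longrightarrow> dist (z n) b < min R 1"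
      by (auto simp: eventually_sequentially)
    have psi: "0 \<le> psi w (z n)" if "N \<le> n" for n
    proof -
      have "norm (z n - w) \<le> norm (b - w) + 1"
        using norm_triangle_ineq[of "z n - b" "b - w"] N[OF that] by (simp add: dist_norm)
      then have "norm (F w) * norm (z n - w) \<le> norm (F w) * (norm (b - w) + 1)"
        by (rule mult_left_mono) simp
      then show ?thesis
        using Cauchy_Schwarz_ineq2[of "F w" "z n - w"] R(2)[OF z_dom, of n] N[OF that]
        unfolding psi_def by (simp add: abs_le_iff)
    qed
    have step: "E (Suc n) w \<le> E n w" if "Suc N \<le> n" for n
    proof -
      have "0 \<le> 2 * lam (Suc n) * psi w (z (Suc n))"
        using psi[of "Suc n"] lam_pos[of "Suc n"] that by simp
      then show ?thesis using E_Suc_le[OF _ w, of n] that by simp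
    qed
    have "decseq (\<lambda>n. E (n + Suc N) w)" using step by (intro decseq_SucI) simp
    then have "k * (norm (b - w))\<^sup>2 \<le> E (n + Suc N) w" for n
      by (rule decseq_ge) (rule LIMSEQ_ignore_initial_segment[OF E_lim])
    then have "k * (norm (b - w))\<^sup>2 \<le> E n w" if "Suc N \<le> n" for n
      using that by (metis le_add_diff_inverse2)
    then show ?thesis by (auto simp: eventually_sequentially)
  qed
  obtain Q r where r: "strict_mono (r :: nat \<Rightarrow> nat)"
    "\<And>j. norm (z (Suc (r j)) - z (r j)) \<le> Q * norm (zb (Suc (r j)) - b)"
    using frequently_step_le_distance[OF limb b] by blast
  define e where "e n = zb (Suc n) - b" for n
  have e_pos: "0 < norm (e n)" for n using b zb_dom[of "Suc n"] by (auto simp: e_def)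
  have e_lim: "e \<longlonglongrightarrow> 0"
    unfolding e_def using tendsto_diff[OF LIMSEQ_Suc[OF limb] tendsto_const[of b]] by simp
  define u where "u j = e (r j) /\<^sub>R norm (e (r j))" for j
  have u_norm: "norm (u j) = 1" for j using e_pos[of "r j"] by (simp add: u_def)
  then have "bounded (range u)" unfolding bounded_iff by (intro exI[of _ 1]) auto
  then obtain q v where q: "strict_mono (q :: nat \<Rightarrow> nat)" "(\<lambda>j. u (q j)) \<longlonglongrightarrow> v"
    using bounded_sequence_cluster_point by blast
  have sub: "filterlim (\<lambda>j. r (q j)) sequentially sequentially"
    using filterlim_compose[OF filterlim_subseq[OF r(1)] filterlim_subseq[OF q(1)]] by simp
  have v_le: "v \<bullet> (w - b) \<le> 0" if w: "w \<in> D" for w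
  proof -
    have "2 * (u (q j) \<bullet> (w - b)) \<le> (1 + Q\<^sup>2) * norm (e (r (q j)))"
      if j: "k * (norm (b - w))\<^sup>2 \<le> E (r (q j)) w" for j
    proof -
      define n where "n = r (q j)"
      define d where "d = norm (z (Suc n) - z n)"
      \<comment> \<open>\<open>theta n \<le> 2\<close> and \<open>1 \<le> k\<close> bound the step
        term by \<open>k * d\<^sup>2\<close>, so that \<open>k\<close> cancels.\<close>
      have "(y n)\<^sup>2 / 2 \<le> d\<^sup>2"
        unfolding y_squared d_def using mult_right_mono[OF theta_le_2[of n], of "(norm (z (Suc n) - z n))\<^sup>2"] by simp
      also have "\<dots> \<le> k * d\<^sup>2" using mult_right_mono[OF k, of "d\<^sup>2"] by simp
      finally have "k * (norm (b - w))\<^sup>2 \<le> k * (norm (zb (Suc n) - w))\<^sup>2 + k * d\<^sup>2"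
        using j unfolding n_def[symmetric] E_eq k_def[symmetric] by linarith
      then have "k * (norm (b - w))\<^sup>2 \<le> k * ((norm (zb (Suc n) - w))\<^sup>2 + d\<^sup>2)"
        by (simp add: distrib_left)
      then have "(norm (b - w))\<^sup>2 \<le> (norm (zb (Suc n) - w))\<^sup>2 + d\<^sup>2"
        by (rule mult_left_le_imp_le) (use k in simp)
      moreover have "zb (Suc n) - w = e n - (w - b)" by (simp add: e_def)
      ultimately have "(norm (w - b))\<^sup>2 \<le> (norm (e n - (w - b)))\<^sup>2 + d\<^sup>2"
        by (simp only: norm_minus_commute)
      moreover have "(norm (e n - (w - b)))\<^sup>2
          = (norm (e n))\<^sup>2 - 2 * (e n \<bullet> (w - b)) + (norm (w - b))\<^sup>2"
        using dot_norm_neg[of "e n" "w - b"] by (simp add: field_simps)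
      ultimately have "2 * (e n \<bullet> (w - b)) \<le> (norm (e n))\<^sup>2 + d\<^sup>2" by linarith
      \<comment> \<open>Along the chosen subsequence the step is of order \<open>norm (e n)\<close>,
        so the right side still vanishes after division by \<open>norm (e n)\<close>.\<close>
      also have "d\<^sup>2 \<le> (Q * norm (e n))\<^sup>2"
        unfolding d_def using r(2)[of "q j"] by (intro power_mono) (simp_all add: n_def e_def)
      finally have "2 * (e n \<bullet> (w - b)) \<le> ((1 + Q\<^sup>2) * norm (e n)) * norm (e n)"
        by (simp add: power2_eq_square algebra_simps)
      then have "2 * (e n \<bullet> (w - b)) / norm (e n) \<le> (1 + Q\<^sup>2) * norm (e n)"
        using e_pos[of n] by (simp add: pos_divide_le_eq)
      moreover have "u (q j) \<bullet> (w - b) = (e n \<bullet> (w - b)) / norm (e n)"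
        by (simp add: u_def n_def divide_inverse_commute)
      ultimately show ?thesis by (simp add: n_def)
    qed
    moreover have "\<forall>\<^sub>F j in sequentially. k * (norm (b - w))\<^sup>2 \<le> E (r (q j)) w"
      using eventually_compose_filterlim[OF E_ge[OF w] sub] .
    ultimately have ev: "\<forall>\<^sub>F j in sequentially. 2 * (u (q j) \<bullet> (w - b)) \<le> (1 + Q\<^sup>2) * norm (e (r (q j)))"
      by (auto elim: eventually_mono)
    have "(\<lambda>j. (1 + Q\<^sup>2) * norm (e (r (q j)))) \<longlonglongrightarrow> (1 + Q\<^sup>2) * norm (0::'a)"
      by (intro tendsto_intros filterlim_compose[OF e_lim sub])
    moreover have "(\<lambda>j. 2 * (u (q j) \<bullet> (w - b))) \<longlonglongrightarrow> 2 * (v \<bullet> (w - b))"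
      by (intro tendsto_intros q(2))
    ultimately have "2 * (v \<bullet> (w - b)) \<le> (1 + Q\<^sup>2) * norm (0::'a)"
      using ev by (intro tendsto_le[of sequentially]) auto
    then show ?thesis by simp
  qed
  \<comment> \<open>For \<open>w = zb (Suc (r (q j)))\<close> the vector \<open>w - b\<close> is a
    positive multiple of \<open>u (q j)\<close>.\<close>
  have "v \<bullet> u (q j) \<le> 0" for j
    using v_le[OF zb_dom[of "Suc (r (q j))"]] e_pos[of "r (q j)"]
    by (simp add: u_def e_def[symmetric] mult_nonneg_nonpos)
  then have "v \<bullet> v \<le> 0"
    by (intro tendsto_upperbound[OF tendsto_inner[OF tendsto_const q(2)]]) auto
  moreover have "norm v = 1"
    using LIMSEQ_unique[OF tendsto_norm[OF q(2)]] u_norm by simp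
  then have "v \<bullet> v = 1" using power2_norm_eq_inner[of v] by simp
  ultimately show False by simp
qed

subsection \<open>Convergence\<close>

lemma cluster_point_in_dom:
  assumes "s \<in> VI_solutions g F" and "filterlim r at_top sequentially"
    and "(\<lambda>j. z (r j)) \<longlonglongrightarrow> b"
  shows "b \<in> D"
  using cluster_point_outside_dom_is_limit[OF assms] limit_in_dom[OF assms(1)] by blast

text \<open>Indices with ever larger difference quotients would have iterates clustering at a point
  of the domain. \<open>F\<close> is Lipschitz near it, and both ends of a step get there because
  the steps vanish.\<close>

lemma F_eventually_lipschitz:
  assumes s: "s \<in> VI_solutions g F"
  obtains L where "0 < L"
    and "\<forall>\<^sub>F n in sequentially. norm (F (z (Suc n)) - F (z n)) \<le> L * norm (z (Suc n) - z n)"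
proof (rule ccontr)
  assume neg: "\<not> thesis"
  have "\<exists>n\<ge>N. real (Suc N) * norm (z (Suc n) - z n) < norm (F (z (Suc n)) - F (z n))" for N
  proof (rule ccontr)
    assume "\<not> ?thesis"
    then have "\<forall>\<^sub>F n in sequentially. norm (F (z (Suc n)) - F (z n)) \<le> real (Suc N) * norm (z (Suc n) - z n)"
      unfolding eventually_sequentially by (intro exI[of _ N]) (simp add: not_less)
    then show False using neg that[of "real (Suc N)"] by simp
  qed
  then obtain m where m: "\<And>N. N \<le> m N"
    "\<And>N. real (Suc N) * norm (z (Suc (m N)) - z (m N)) < norm (F (z (Suc (m N))) - F (z (m N)))"
    by metis
  have "bounded (range (\<lambda>N. z (m N)))" by (rule bounded_subset[OF bounded_z[OF s]]) auto
  then obtain q p where q: "strict_mono (q :: nat \<Rightarrow> nat)" "(\<lambda>j. z (m (q j))) \<longlonglongrightarrow> p"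
    using bounded_sequence_cluster_point[of "\<lambda>N. z (m N)"] by blast
  have q_top: "filterlim q at_top sequentially" by (rule filterlim_subseq[OF q(1)])
  have "filterlim (\<lambda>j. m (q j)) at_top sequentially"
    by (rule filterlim_at_top_mono[OF q_top]) (use m(1) in simp)
  note mq = this
  have p: "p \<in> D" by (rule cluster_point_in_dom[OF s mq q(2)])
  then obtain R L where R: "0 < R" and L: "lipschitz_on L (cball p R \<inter> D) F"
    using lip_F by (auto simp: locally_lipschitz_on_def)
  have "(\<lambda>j. z (m (q j)) + (z (Suc (m (q j))) - z (m (q j)))) \<longlonglongrightarrow> p + 0"
    by (rule tendsto_add[OF q(2) filterlim_compose[OF z_diff_tendsto_zero[OF s] mq]])
  then have q2: "(\<lambda>j. z (Suc (m (q j)))) \<longlonglongrightarrow> p" by simp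
  have ev: "\<forall>\<^sub>F j in sequentially. dist (z (m (q j))) p < R \<and> dist (z (Suc (m (q j)))) p < R
      \<and> nat \<lceil>L\<rceil> \<le> q j"
    using q_top unfolding filterlim_at_top
    by (intro eventually_conj tendstoD[OF q(2) R] tendstoD[OF q2 R]) blast
  then obtain j where j: "dist (z (m (q j))) p < R" "dist (z (Suc (m (q j)))) p < R" "nat \<lceil>L\<rceil> \<le> q j"
    by (auto simp: eventually_sequentially)
  have "dist (F (z (Suc (m (q j))))) (F (z (m (q j)))) \<le> L * dist (z (Suc (m (q j)))) (z (m (q j)))"
    using lipschitz_onD[OF L] j z_dom by (simp add: dist_commute)
  also have "\<dots> \<le> real (Suc (q j)) * dist (z (Suc (m (q j)))) (z (m (q j)))"
  proof (rule mult_right_mono)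
    show "L \<le> real (Suc (q j))" using j(3) by linarith
  qed simp
  finally show False using m(2)[of "q j"] by (simp add: dist_norm)
qed

text \<open>When the quotient determines the step size, \<open>theta n\<close> cancels
  \<open>lam n\<close>, leaving \<open>phi\<^sup>2 / (4 * lam (n - 1))\<close> times a ratio of at
  least \<open>1 / L\<^sup>2\<close>. Otherwise the step size does not fall or equals
  \<open>lam_max\<close>.\<close>

lemma lam_eventually_bounded_below:
  assumes s: "s \<in> VI_solutions g F"
  obtains c where "0 < c" and "\<forall>\<^sub>F n in sequentially. c \<le> lam n"
proof -
  obtain L where L: "0 < L"
    "\<forall>\<^sub>F n in sequentially. norm (F (z (Suc n)) - F (z n)) \<le> L * norm (z (Suc n) - z n)"
    using F_eventually_lipschitz[OF s] by blast
  then obtain N0 where "\<And>n. N0 \<le> n \<Longrightarrow> norm (F (z (Suc n)) - F (z n)) \<le> L * norm (z (Suc n) - z n)"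
    by (auto simp: eventually_sequentially)
  \<comment> \<open>From index 2 on, \<open>lam (n - 1)\<close> is at most \<open>lam_max\<close>;
    \<open>lam 0\<close> need not be.\<close>
  then obtain N where N: "2 \<le> N"
    "\<And>n. N \<le> n \<Longrightarrow> norm (F (z (Suc n)) - F (z n)) \<le> L * norm (z (Suc n) - z n)"
    using that[of "max N0 2"] by (metis max.cobounded2 max.boundedE)
  define c0 where "c0 = phi\<^sup>2 / (4 * lam_max * L\<^sup>2)"
  define c where "c = min (lam N) (min lam_max c0)"
  have c0: "0 < c0" using phi_gt_1 lam_max_pos L(1) by (simp add: c0_def)
  have "c \<le> lam n" if "N \<le> n" for n using that
  proof (induction n rule: dec_induct)
    case base
    then show ?case by (simp add: c_def)
  next
    case (step n)
    show ?case
    proof (rule lam_Suc_cases[of n])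
      assume "lam n \<le> lam (Suc n)"
      then show ?thesis using step by simp
    next
      assume "lam (Suc n) = lam_max"
      then show ?thesis by (simp add: c_def)
    next
      define dF dz where "dF = norm (F (z (Suc n)) - F (z n))" and "dz = norm (z (Suc n) - z n)"
      assume F: "F (z (Suc n)) \<noteq> F (z n)"
        and l: "lam (Suc n) = phi * theta n / (4 * lam n) *
          ((norm (z (Suc n) - z n))\<^sup>2 / (norm (F (z (Suc n)) - F (z n)))\<^sup>2)"
      obtain m where m: "n = Suc (Suc m)" using step(1) N(1)
        by (metis Suc_le_D numeral_2_eq_2 order_trans Suc_le_mono)
      have dF: "0 < dF" using F by (simp add: dF_def)
      have "dF\<^sup>2 \<le> (L * dz)\<^sup>2"
        using N(2)[OF step(1)] dF unfolding dF_def dz_def by (intro power_mono) auto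
      then have ratio: "1 / L\<^sup>2 \<le> dz\<^sup>2 / dF\<^sup>2"
        using dF L(1) by (simp add: field_simps)
      have "lam (Suc n) = phi\<^sup>2 / (4 * lam (Suc m)) * (dz\<^sup>2 / dF\<^sup>2)"
        unfolding l dF_def[symmetric] dz_def[symmetric]
        using lam_pos[of n] theta_Suc[of "Suc m"] by (simp add: m power2_eq_square)
      moreover have "phi\<^sup>2 / (4 * lam_max) * (1 / L\<^sup>2) \<le> phi\<^sup>2 / (4 * lam (Suc m)) * (dz\<^sup>2 / dF\<^sup>2)"
        using lam_pos[of "Suc m"] lam_Suc_le_max[of m] L(1)
        by (intro mult_mono ratio divide_left_mono) auto
      ultimately have "c0 \<le> lam (Suc n)" by (simp add: c0_def)
      then show ?thesis by (simp add: c_def)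
    qed
  qed
  then have "\<forall>\<^sub>F n in sequentially. c \<le> lam n" by (auto simp: eventually_sequentially)
  moreover have "0 < c" using lam_pos[of N] lam_max_pos c0 by (simp add: c_def)
  ultimately show thesis by (rule that[rotated])
qed

text \<open>Divide the prox inequality by \<open>lam n\<close>: the displacement term vanishes
  because the step sizes stay away from zero, and \<open>F\<close> is continuous at \<open>p\<close>
  relative to the domain.\<close>

lemma cluster_point_is_solution:
  assumes s: "s \<in> VI_solutions g F" and r: "filterlim r at_top sequentially"
    and zr: "(\<lambda>j. z (r j)) \<longlonglongrightarrow> p"
  shows "p \<in> VI_solutions g F"
proof -
  have p: "p \<in> D" by (rule cluster_point_in_dom[OF assms])
  obtain c where c: "0 < c" "\<forall>\<^sub>F n in sequentially. c \<le> lam n"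
    using lam_eventually_bounded_below[OF s] by blast
  have z1: "(\<lambda>j. z (Suc (r j))) \<longlonglongrightarrow> p"
    using tendsto_add[OF zr filterlim_compose[OF z_diff_tendsto_zero[OF s] r]] by simp
  obtain R L where R: "0 < R" and L: "lipschitz_on L (cball p R \<inter> D) F"
    using lip_F p by (auto simp: locally_lipschitz_on_def)
  have "\<forall>\<^sub>F j in sequentially. z (r j) \<in> cball p R \<inter> D"
    using tendstoD[OF zr R] by eventually_elim (use z_dom in \<open>simp add: dist_commute\<close>)
  then have F_lim: "(\<lambda>j. F (z (r j))) \<longlonglongrightarrow> F p"
    by (rule continuous_on_tendsto_compose[OF lipschitz_on_continuous_on[OF L] zr, rotated])
      (use R p in simp)
  define t where "t n = (z (Suc n) - zb n) /\<^sub>R lam n" for n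
  have "t \<longlonglongrightarrow> 0"
  proof (rule Lim_null_comparison)
    show "\<forall>\<^sub>F n in sequentially. norm (t n) \<le> norm (z (Suc n) - zb n) / c"
      using c(2)
    proof eventually_elim
      case (elim n)
      have "norm (z (Suc n) - zb n) / lam n \<le> norm (z (Suc n) - zb n) / c"
        using elim c(1) by (intro divide_left_mono) auto
      then show ?case using lam_pos[of n] by (simp add: t_def divide_inverse_commute)
    qed
    have "(\<lambda>n. norm (z (Suc n) - zb n) / c) \<longlonglongrightarrow> norm (0::'a) / c"
      using c(1) by (intro tendsto_intros z_Suc_minus_zb_tendsto_zero[OF s]) auto
    then show "(\<lambda>n. norm (z (Suc n) - zb n) / c) \<longlonglongrightarrow> 0" by simp
  qed
  have key: "G p \<le> G w + F p \<bullet> (w - p)" if w: "w \<in> D" for w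
  \<comment> \<open>Lower semicontinuity only bounds \<open>G\<close> from below along the sequence,
    so the limit is taken for each level \<open>d\<close> below \<open>G p\<close>.\<close>
  proof (rule dense_le)
    fix d assume d: "d < G p"
    have "\<forall>\<^sub>F x in nhds p. ereal d < g x"
      using lsc_g d g_eq_G[OF p] by (auto simp: lower_semicontinuous_def)
    then have "\<forall>\<^sub>F j in sequentially. ereal d < g (z (Suc (r j)))"
      by (rule eventually_compose_filterlim) (rule z1)
    moreover have "\<forall>\<^sub>F j in sequentially. 1 \<le> r j" using r by (simp add: filterlim_at_top)
    ultimately have "\<forall>\<^sub>F j in sequentially. d \<le> G w + (t (r j) + F (z (r j))) \<bullet> (w - z (Suc (r j)))"
    proof eventually_elim
      case (elim j)
      obtain n where n: "r j = Suc n" using elim(2) by (cases "r j") auto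
      have "d < G (z (Suc (r j)))" using elim(1) g_eq_G[OF z_dom] by simp
      moreover have "z (Suc (Suc n)) - zb (Suc n) + lam (Suc n) *\<^sub>R F (z (Suc n))
          = lam (Suc n) *\<^sub>R (t (Suc n) + F (z (Suc n)))"
        using lam_pos[of "Suc n"] by (simp add: t_def scaleR_add_right)
      then have "lam (Suc n) * (G (z (Suc (Suc n))) - G w)
          \<le> lam (Suc n) * ((t (Suc n) + F (z (Suc n))) \<bullet> (w - z (Suc (Suc n))))"
        using z_prox_inequality[OF w, of n] by simp
      then have "G (z (Suc (Suc n))) - G w \<le> (t (Suc n) + F (z (Suc n))) \<bullet> (w - z (Suc (Suc n)))"
        using lam_pos[of "Suc n"] by simp
      ultimately show ?case unfolding n by linarith
    qed
    moreover have "(\<lambda>j. G w + (t (r j) + F (z (r j))) \<bullet> (w - z (Suc (r j))))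
        \<longlonglongrightarrow> G w + (0 + F p) \<bullet> (w - p)"
      by (intro tendsto_add tendsto_inner tendsto_diff tendsto_const F_lim z1
          filterlim_compose[OF \<open>t \<longlonglongrightarrow> 0\<close> r])
    ultimately have "d \<le> G w + (0 + F p) \<bullet> (w - p)"
      by (intro tendsto_lowerbound) auto
    then show "d \<le> G w + F p \<bullet> (w - p)" by simp
  qed
  have "0 \<le> ereal (F p \<bullet> (w - p)) + g w - g p" for w
  proof (cases "w \<in> D")
    case True
    show ?thesis using key[OF True] unfolding g_eq_G[OF True] g_eq_G[OF p] by simp
  next
    case False
    then have "g w = \<infinity>" by (simp add: effective_domain_def)
    then show ?thesis unfolding g_eq_G[OF p] by simp
  qed
  then show ?thesis using p by (simp add: VI_solutions_def)
qed

section \<open>Convergence of the whole sequence\<close>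

theorem converges_to_solution:
  assumes "VI_solutions g F \<noteq> {}"
  shows "\<exists>s \<in> VI_solutions g F. z \<longlonglongrightarrow> s \<and> zb \<longlonglongrightarrow> s"
proof -
  obtain s where s: "s \<in> VI_solutions g F" using assms by blast
  obtain r p where r: "strict_mono (r :: nat \<Rightarrow> nat)" "(\<lambda>j. z (r j)) \<longlonglongrightarrow> p"
    using bounded_sequence_cluster_point[OF bounded_z[OF s]] by blast
  have r_top: "filterlim r at_top sequentially" by (rule filterlim_subseq[OF r(1)])
  have p: "p \<in> VI_solutions g F" by (rule cluster_point_is_solution[OF s r_top r(2)])
  obtain l where l: "(\<lambda>n. E n p) \<longlonglongrightarrow> l" using E_solution_convergent[OF p] by blast
  have "(\<lambda>j. z (r j) + (z (Suc (r j)) - z (r j)) - (z (Suc (r j)) - zb (Suc (r j)))) \<longlonglongrightarrow> p + 0 - 0"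
    by (intro tendsto_add tendsto_diff[OF tendsto_add] r(2)
        filterlim_compose[OF z_diff_tendsto_zero[OF s] r_top]
        filterlim_compose[OF LIMSEQ_Suc[OF z_minus_zb_tendsto_zero[OF s]] r_top])
  then have zbr: "(\<lambda>j. zb (Suc (r j))) \<longlonglongrightarrow> p" by simp
  have "(\<lambda>j. phi / (phi - 1) * (norm (zb (Suc (r j)) - p))\<^sup>2 + (y (r j))\<^sup>2 / 2)
      \<longlonglongrightarrow> phi / (phi - 1) * (norm (p - p))\<^sup>2 + 0\<^sup>2 / 2"
    by (intro tendsto_intros zbr filterlim_compose[OF y_tendsto_zero[OF s] r_top]) simp
  then have "(\<lambda>j. E (r j) p) \<longlonglongrightarrow> 0" by (simp add: E_eq)
  \<comment> \<open>\<open>E n p\<close> converges because \<open>p\<close> is a solution, so its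
    limit along \<open>r\<close> is the limit of the whole sequence.\<close>
  then have "l = 0" using LIMSEQ_unique[OF filterlim_compose[OF l r_top]] by blast
  have "(\<lambda>n. (norm (zb (Suc n) - p))\<^sup>2) \<longlonglongrightarrow> 0"
  proof (rule Lim_null_comparison)
    show "\<forall>\<^sub>F n in sequentially. norm ((norm (zb (Suc n) - p))\<^sup>2) \<le> E n p"
      using norm_zb_le_E by (intro always_eventually) simp
    show "(\<lambda>n. E n p) \<longlonglongrightarrow> 0" using l \<open>l = 0\<close> by simp
  qed
  then have "(\<lambda>n. norm (zb (Suc n) - p)) \<longlonglongrightarrow> 0"
    using tendsto_real_sqrt[of "\<lambda>n. (norm (zb (Suc n) - p))\<^sup>2" 0] by simp
  then have "(\<lambda>n. zb (Suc n)) \<longlonglongrightarrow> p" by (simp add: LIM_zero_cancel tendsto_norm_zero_iff)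
  then have zb: "zb \<longlonglongrightarrow> p" by (rule LIMSEQ_imp_Suc)
  then have "z \<longlonglongrightarrow> p" using tendsto_add[OF zb z_minus_zb_tendsto_zero[OF s]] by simp
  then show ?thesis using p zb by blast
qed

end

theorem theorem2:
  fixes g :: "'a::euclidean_space \<Rightarrow> ereal"
    and F :: "'a \<Rightarrow> 'a"
    and phi lam_max :: real
    and z zb :: "nat \<Rightarrow> 'a"
    and lam theta :: "nat \<Rightarrow> real"
  assumes "proper g" and "ereal_convex g" and "lower_semicontinuous g"
    and "monotone_operator_on (effective_domain g) F"
    and "locally_lipschitz_on (effective_domain g) F"
    and "VI_solutions g F \<noteq> {}"
    and "z 0 \<in> effective_domain g" and "z 1 \<in> effective_domain g"
    and "0 < lam 0"
    and "1 < phi" and "phi \<le> (sqrt 5 + 1) / 2"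
    and "0 < lam_max"
    and "aGRAAL g F phi lam_max z zb lam theta"
  shows "\<exists>s \<in> VI_solutions g F. z \<longlonglongrightarrow> s \<and> zb \<longlonglongrightarrow> s"
proof -
  interpret aGRAAL_run g F phi lam_max z zb lam theta
    by unfold_locales (fact assms)+
  show ?thesis by (rule converges_to_solution) (fact assms)
qed

end
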